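(* Let $G$ be a (finite, or countable locally finite) cavity-monotone network such that for every $t>0$ the cavity equation $\mathbf x=t\Gamma_G(\mathbf x)$ has a unique globally attractive solution $\mathbf x(t)$. Then $t\mapsto\mathbf x(t)$ is coordinatewise non-decreasing, the limit $\overline{\mathbf x}:=\lim_{t\to\infty}\mathbf x(t)$ exists in $(0,\infty]^{\vec E}$, and $\overline{\mathbf x}$ is the smallest (coordinatewise) element of $(0,\infty]^{\vec E}$ solving the cavity equation at infinite activity $$\overline{\mathbf x}=(\overline\Gamma_G\circ\Gamma_G)(\overline{\mathbf x}).$$ Moreover, if $\mathcal L$ is a unimodular probability measure on $\mathcal G_*$ concentrated on cavity-monotone networks with $\mathcal L[\mathrm{rank}(\mu_\circ)]<\infty$, then $$m(\mathcal L)=\frac12\mathcal L\Big[U_{\mu_\circ}\big(\overline x_{i\to\circ}:i\in\partial\circ\big)\Big].$$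
   Context: Measures over subsets: for a finite set $E$, a measure is $\mu:2^E\to[0,\infty)$; $Z(\mathbf w)=\sum_{F\subseteq E}\mu(F)\mathbf w^F$, $\mathbf w^F=\prod_{e\in F}w_e$; the cavity ratio is $\Gamma^e_\mu(\mathbf w')=Z^{/e}(\mathbf w')/Z^{\setminus e}(\mathbf w')$ where $Z^{\setminus e}(\mathbf w')=\sum_{F\not\ni e}\mu(F)\mathbf w'^F$, $Z^{/e}(\mathbf w')=\sum_{F\not\ni e}\mu(F\cup\{e\})\mathbf w'^F$; for $\mathbf w\in[0,\infty)^E$ with $Z(\mathbf w)>0$, $\mathbb P^{\mathbf w}_\mu(\mathcal F=F)=\mu(F)\mathbf w^F/Z(\mathbf w)$ and $U_\mu(\mathbf w)=\mathbb E^{\mathbf w}_\mu|\mathcal F|$; for cavity-monotone $\mu$ and $\mathbf y\in(0,\infty]^E$, $U_\mu(\mathbf y):=\lim_{n\to\infty}U_\mu(\mathbf y\wedge n)$ (coordinatewise minimum). $\mathrm{rank}(\mu)=\max\{|F|:\mu(F)>0\}$. $\mu$ is Rayleigh if for all $\mathbf w\in(0,\infty)^E$, $e\neq f$: $\mathbb P^{\mathbf w}_\mu(e,f\in\mathcal F)\le\mathbb P^{\mathbf w}_\mu(e\in\mathcal F)\mathbb P^{\mathbf w}_\mu(f\in\mathcal F)$; size-increasing if for all $\mathbf w\in(0,\infty)^E$, $e\in E$: $\mathbb E^{\mathbf w}_\mu[|\mathcal F|\mathbf 1_{e\in\mathcal F}]>\mathbb E^{\mathbf w}_\mu|\mathcal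 F|\,\mathbb P^{\mathbf w}_\mu(e\in\mathcal F)$; cavity-monotone if $\mu(\emptyset)>0$, Rayleigh and size-increasing. Networks: a network is a simple locally finite graph $G=(V,E)$ with, for each $i\in V$, a local measure $\mu_i$ over the subsets of $E_i$ (edges incident to $i$); cavity-monotone if every $\mu_i$ is; $\partial i$ is the set of neighbours of $i$. Configurations $\mathbf x\in[0,\infty)^{\vec E}$; cavity operator $\Gamma_G(\mathbf x)_{i\to j}=\Gamma^{ij}_{\mu_i}(x_{k\to i}:k\in\partial i\setminus\{j\})$; cavity equation at activity $t$: $\mathbf x=t\Gamma_G(\mathbf x)$; a solution is globally attractive if the iterates of $t\Gamma_G$ from any configuration converge coordinatewise to it. For $\mathbf y\in(0,\infty]^{\vec E}$, $\Gamma_G(\mathbf y):=\lim_{n\to\infty}\Gamma_G(\mathbf y\wedge n)$ (a non-increasing limit). For $\mathbf x\in[0,\infty)^{\vec E}$, $\overline\Gamma_G(\mathbf x):=\lim_{t\to\infty}t\Gamma_G(t\mathbf x)\in(0,\infty]^{\vec E}$ (a non-decreasing limit). Unimodular measures: $\mathcal G_*$ is the Polish space (local topology) of connected locally finite rooted networks $(G,\circ)$ up to isomorphism; $\mathcal L\in\mathcal P(\mathcal G_* )$ is unimodular if for every Borel $f\ge0$ on networks with an ordered pair of adjacent distinguished vertices, $\mathcal L[\sum_{i\in\partial\circ}f(G,\circ,i)]=\mathcal L[\sum_{i\in\partial\circ}f(G,i,\circ)]$. For such $\mathcal L$ with $\mathcal L[\mathrm{rank}(\mu_\circ)]<\infty$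 and concentrated on cavity-monotone networks, the cavity equation has $\mathcal L$-a.s. a unique globally attractive solution $\mathbf x(t)$ for all $t>0$; $u(\mathcal L;t):=\frac12\mathcal L[U_{\mu_\circ}(x_{i\to\circ}(t):i\in\partial\circ)]$ and $m(\mathcal L):=\lim_{t\to\infty}u(\mathcal L;t)$. *)

theory Defs
  imports "HOL-Probability.Probability"
begin

section \<open>Measures over subsets of a finite ground set S\<close>

text \<open>A measure over the subsets of a finite set S is a function mu on sets;
only its values on subsets of S matter. Weights are functions w on S.\<close>

definition is_subset_measure :: "'a set \<Rightarrow> ('a set \<Rightarrow> real) \<Rightarrow> bool" where
  "is_subset_measure S mu \<longleftrightarrow> finite S \<and> (\<forall>F. F \<subseteq> S \<longrightarrow> 0 \<le> mu F)"

definition Zpart :: "'a set \<Rightarrow> ('a set \<Rightarrow> real) \<Rightarrow> ('a \<Rightarrow> real) \<Rightarrow> real" where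
  "Zpart S mu w = (\<Sum>F\<in>Pow S. mu F * prod w F)"

definition Zdel :: "'a set \<Rightarrow> ('a set \<Rightarrow> real) \<Rightarrow> 'a \<Rightarrow> ('a \<Rightarrow> real) \<Rightarrow> real" where
  "Zdel S mu e w = (\<Sum>F\<in>Pow (S - {e}). mu F * prod w F)"

definition Zcon :: "'a set \<Rightarrow> ('a set \<Rightarrow> real) \<Rightarrow> 'a \<Rightarrow> ('a \<Rightarrow> real) \<Rightarrow> real" where
  "Zcon S mu e w = (\<Sum>F\<in>Pow (S - {e}). mu (insert e F) * prod w F)"

text \<open>Cavity ratio Gamma^e_mu(w).\<close>
definition cavity_ratio :: "'a set \<Rightarrow> ('a set \<Rightarrow> real) \<Rightarrow> 'a \<Rightarrow> ('a \<Rightarrow> real) \<Rightarrow> real" where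
  "cavity_ratio S mu e w = Zcon S mu e w / Zdel S mu e w"

text \<open>Probability of an event A under P^w_mu.\<close>
definition Prb :: "'a set \<Rightarrow> ('a set \<Rightarrow> real) \<Rightarrow> ('a \<Rightarrow> real) \<Rightarrow> ('a set \<Rightarrow> bool) \<Rightarrow> real" where
  "Prb S mu w A = (\<Sum>F\<in>{F\<in>Pow S. A F}. mu F * prod w F) / Zpart S mu w"

text \<open>Expectation of a function g of the random set under P^w_mu.\<close>
definition Exv :: "'a set \<Rightarrow> ('a set \<Rightarrow> real) \<Rightarrow> ('a \<Rightarrow> real) \<Rightarrow> ('a set \<Rightarrow> real) \<Rightarrow> real" where
  "Exv S mu w g = (\<Sum>F\<in>Pow S. g F * mu F * prod w F) / Zpart S mu w"

text \<open>U_mu(w) = expected size.\<close>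
definition Umean :: "'a set \<Rightarrow> ('a set \<Rightarrow> real) \<Rightarrow> ('a \<Rightarrow> real) \<Rightarrow> real" where
  "Umean S mu w = Exv S mu w (\<lambda>F. real (card F))"

definition rank_meas :: "'a set \<Rightarrow> ('a set \<Rightarrow> real) \<Rightarrow> nat" where
  "rank_meas S mu = Max {card F | F. F \<subseteq> S \<and> 0 < mu F}"

definition rayleigh :: "'a set \<Rightarrow> ('a set \<Rightarrow> real) \<Rightarrow> bool" where
  "rayleigh S mu \<longleftrightarrow> (\<forall>w. (\<forall>e\<in>S. 0 < w e) \<longrightarrow>
     (\<forall>e\<in>S. \<forall>f\<in>S. e \<noteq> f \<longrightarrow>
        Prb S mu w (\<lambda>F. e \<in> F \<and> f \<in> F) \<le> Prb S mu w (\<lambda>F. e \<in> F) * Prb S mu w (\<lambda>F. f \<in> F)))"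

definition size_increasing :: "'a set \<Rightarrow> ('a set \<Rightarrow> real) \<Rightarrow> bool" where
  "size_increasing S mu \<longleftrightarrow> (\<forall>w. (\<forall>e\<in>S. 0 < w e) \<longrightarrow>
     (\<forall>e\<in>S. Exv S mu w (\<lambda>F. real (card F) * (if e \<in> F then 1 else 0))
              > Umean S mu w * Prb S mu w (\<lambda>F. e \<in> F)))"

definition cavity_monotone :: "'a set \<Rightarrow> ('a set \<Rightarrow> real) \<Rightarrow> bool" where
  "cavity_monotone S mu \<longleftrightarrow> is_subset_measure S mu \<and> 0 < mu {} \<and> rayleigh S mu \<and> size_increasing S mu"

text \<open>U_mu(y) for y in (0,infinity]^S: limit of U_mu(y /\ n).\<close>
definition Uext :: "'a set \<Rightarrow> ('a set \<Rightarrow> real) \<Rightarrow> ('a \<Rightarrow> ereal) \<Rightarrow> real" where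
  "Uext S mu y = lim (\<lambda>n::nat. Umean S mu (\<lambda>e. real_of_ereal (min (y e) (ereal (real n)))))"

section \<open>Networks\<close>

text \<open>A network: vertex set V, symmetric irreflexive adjacency E (simple graph),
and local measures mu i over subsets of the edges at i; since the graph is simple,
the edge ij at i is identified with the neighbour j, so mu i is a measure over
subsets of the neighbourhood nbrs E i.\<close>

definition nbrs :: "('v \<Rightarrow> 'v \<Rightarrow> bool) \<Rightarrow> 'v \<Rightarrow> 'v set" where
  "nbrs E i = {j. E i j}"

definition network :: "'v set \<Rightarrow> ('v \<Rightarrow> 'v \<Rightarrow> bool) \<Rightarrow> bool" where
  "network V E \<longleftrightarrow> countable V \<and>
     (\<forall>u v. E u v \<longrightarrow> u \<in> V \<and> v \<in> V \<and> E v u \<and> u \<noteq> v) \<and>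
     (\<forall>u\<in>V. finite (nbrs E u))"

definition cm_network :: "'v set \<Rightarrow> ('v \<Rightarrow> 'v \<Rightarrow> bool) \<Rightarrow> ('v \<Rightarrow> 'v set \<Rightarrow> real) \<Rightarrow> bool" where
  "cm_network V E mu \<longleftrightarrow> network V E \<and> (\<forall>i\<in>V. cavity_monotone (nbrs E i) (mu i))"

text \<open>Configurations x :: 'v => 'v => real, x i j = x_{i->j} (only values on directed edges matter).\<close>

definition GammaN :: "('v \<Rightarrow> 'v \<Rightarrow> bool) \<Rightarrow> ('v \<Rightarrow> 'v set \<Rightarrow> real) \<Rightarrow> ('v \<Rightarrow> 'v \<Rightarrow> real) \<Rightarrow> 'v \<Rightarrow> 'v \<Rightarrow> real" where
  "GammaN E mu x i j = cavity_ratio (nbrs E i) (mu i) j (\<lambda>k. x k i)"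

definition is_config :: "('v \<Rightarrow> 'v \<Rightarrow> bool) \<Rightarrow> ('v \<Rightarrow> 'v \<Rightarrow> real) \<Rightarrow> bool" where
  "is_config E x \<longleftrightarrow> (\<forall>i j. E i j \<longrightarrow> 0 \<le> x i j)"

definition cavity_step :: "real \<Rightarrow> ('v \<Rightarrow> 'v \<Rightarrow> bool) \<Rightarrow> ('v \<Rightarrow> 'v set \<Rightarrow> real) \<Rightarrow> ('v \<Rightarrow> 'v \<Rightarrow> real) \<Rightarrow> ('v \<Rightarrow> 'v \<Rightarrow> real)" where
  "cavity_step t E mu x = (\<lambda>i j. t * GammaN E mu x i j)"

text \<open>x is a globally attractive solution of x = t Gamma_G(x).\<close>
definition GAS :: "('v \<Rightarrow> 'v \<Rightarrow> bool) \<Rightarrow> ('v \<Rightarrow> 'v set \<Rightarrow> real) \<Rightarrow> real \<Rightarrow> ('v \<Rightarrow> 'v \<Rightarrow> real) \<Rightarrow> bool" where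
  "GAS E mu t x \<longleftrightarrow> is_config E x \<and> (\<forall>i j. E i j \<longrightarrow> x i j = t * GammaN E mu x i j) \<and>
     (\<forall>x0. is_config E x0 \<longrightarrow>
        (\<forall>i j. E i j \<longrightarrow> (\<lambda>n. ((cavity_step t E mu) ^^ n) x0 i j) \<longlonglongrightarrow> x i j))"

text \<open>Uniqueness of a globally attractive solution (on directed edges).\<close>
definition has_unique_GAS :: "('v \<Rightarrow> 'v \<Rightarrow> bool) \<Rightarrow> ('v \<Rightarrow> 'v set \<Rightarrow> real) \<Rightarrow> real \<Rightarrow> bool" where
  "has_unique_GAS E mu t \<longleftrightarrow> (\<exists>x. GAS E mu t x) \<and>
     (\<forall>x y. GAS E mu t x \<longrightarrow> GAS E mu t y \<longrightarrow> (\<forall>i j. E i j \<longrightarrow> x i j = y i j))"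

text \<open>The solution x(t) (normalised to 0 off the directed edges).\<close>
definition xsol :: "('v \<Rightarrow> 'v \<Rightarrow> bool) \<Rightarrow> ('v \<Rightarrow> 'v set \<Rightarrow> real) \<Rightarrow> real \<Rightarrow> 'v \<Rightarrow> 'v \<Rightarrow> real" where
  "xsol E mu t = (\<lambda>i j. if E i j then (SOME x. GAS E mu t x) i j else 0)"

definition xbar :: "('v \<Rightarrow> 'v \<Rightarrow> bool) \<Rightarrow> ('v \<Rightarrow> 'v set \<Rightarrow> real) \<Rightarrow> 'v \<Rightarrow> 'v \<Rightarrow> ereal" where
  "xbar E mu = (\<lambda>i j. Lim at_top (\<lambda>t::real. ereal (xsol E mu t i j)))"

text \<open>Gamma_G(y) for y in (0,infinity]^E: limit of Gamma_G(y /\ n).\<close>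
definition Gamma_ext :: "('v \<Rightarrow> 'v \<Rightarrow> bool) \<Rightarrow> ('v \<Rightarrow> 'v set \<Rightarrow> real) \<Rightarrow> ('v \<Rightarrow> 'v \<Rightarrow> ereal) \<Rightarrow> 'v \<Rightarrow> 'v \<Rightarrow> real" where
  "Gamma_ext E mu y = (\<lambda>i j. lim (\<lambda>n::nat.
      GammaN E mu (\<lambda>k l. real_of_ereal (min (y k l) (ereal (real n)))) i j))"

text \<open>Overline Gamma_G(x) = lim_{t -> infinity} t Gamma_G(t x), valued in (0,infinity].\<close>
definition Gamma_bar :: "('v \<Rightarrow> 'v \<Rightarrow> bool) \<Rightarrow> ('v \<Rightarrow> 'v set \<Rightarrow> real) \<Rightarrow> ('v \<Rightarrow> 'v \<Rightarrow> real) \<Rightarrow> 'v \<Rightarrow> 'v \<Rightarrow> ereal" where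
  "Gamma_bar E mu x = (\<lambda>i j. Lim at_top (\<lambda>t::real. ereal (t * GammaN E mu (\<lambda>k l. t * x k l) i j)))"

text \<open>Cavity equation at infinite activity: y = (Gamma_bar o Gamma)(y) on directed edges.\<close>
definition inf_cavity_eq :: "('v \<Rightarrow> 'v \<Rightarrow> bool) \<Rightarrow> ('v \<Rightarrow> 'v set \<Rightarrow> real) \<Rightarrow> ('v \<Rightarrow> 'v \<Rightarrow> ereal) \<Rightarrow> bool" where
  "inf_cavity_eq E mu y \<longleftrightarrow> (\<forall>i j. E i j \<longrightarrow> y i j = Gamma_bar E mu (Gamma_ext E mu y) i j)"

section \<open>Rooted networks and unimodular laws\<close>

text \<open>Labelled representatives of rooted networks: vertices are natural numbers,
(vertex-set indicator, adjacency, local measures); the root is 0.\<close>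
type_synonym net = "(nat \<Rightarrow> bool) \<times> (nat \<Rightarrow> nat \<Rightarrow> bool) \<times> (nat \<Rightarrow> nat set \<Rightarrow> real)"

definition net_V :: "net \<Rightarrow> nat set" where "net_V G = {v. fst G v}"
definition net_E :: "net \<Rightarrow> nat \<Rightarrow> nat \<Rightarrow> bool" where "net_E G = fst (snd G)"
definition net_mu :: "net \<Rightarrow> nat \<Rightarrow> nat set \<Rightarrow> real" where "net_mu G = snd (snd G)"

definition M_net :: "net measure" where
  "M_net = PiM UNIV (\<lambda>_::nat. count_space (UNIV::bool set))
      \<Otimes>\<^sub>M (PiM UNIV (\<lambda>_::nat. PiM UNIV (\<lambda>_::nat. count_space (UNIV::bool set)))
      \<Otimes>\<^sub>M PiM UNIV (\<lambda>_::nat. PiM UNIV (\<lambda>_::nat set. (borel :: real measure))))"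

text \<open>Connected locally finite network rooted at 0.\<close>
definition rooted_net :: "net \<Rightarrow> bool" where
  "rooted_net G \<longleftrightarrow> network (net_V G) (net_E G) \<and> 0 \<in> net_V G \<and>
     (\<forall>v\<in>net_V G. (0, v) \<in> {(a, b). net_E G a b}\<^sup>*)"

definition net_iso :: "net \<Rightarrow> net \<Rightarrow> (nat \<Rightarrow> nat) \<Rightarrow> bool" where
  "net_iso G G' p \<longleftrightarrow> bij_betw p (net_V G) (net_V G') \<and>
     (\<forall>u\<in>net_V G. \<forall>v\<in>net_V G. net_E G' (p u) (p v) = net_E G u v) \<and>
     (\<forall>u\<in>net_V G. \<forall>F. F \<subseteq> nbrs (net_E G) u \<longrightarrow> net_mu G' (p u) (p ` F) = net_mu G u F)"

text \<open>Functions of a network with an ordered pair of distinguished vertices that are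
invariant under network isomorphism (i.e. functions on isomorphism classes).\<close>
definition iso_invariant :: "(net \<times> nat \<times> nat \<Rightarrow> ennreal) \<Rightarrow> bool" where
  "iso_invariant f \<longleftrightarrow> (\<forall>G G' p a b. net_iso G G' p \<longrightarrow> a \<in> net_V G \<longrightarrow> b \<in> net_V G \<longrightarrow>
       f (G', p a, p b) = f (G, a, b))"

definition unimodular_law :: "net measure \<Rightarrow> bool" where
  "unimodular_law L \<longleftrightarrow> prob_space L \<and> sets L = sets M_net \<and>
     (AE G in L. rooted_net G) \<and>
     (\<forall>f. f \<in> borel_measurable (M_net \<Otimes>\<^sub>M (count_space UNIV \<Otimes>\<^sub>M count_space UNIV)) \<longrightarrow>
        iso_invariant f \<longrightarrow>
        (\<integral>\<^sup>+ G. (\<Sum>i\<in>nbrs (net_E G) 0. f (G, 0, i)) \<partial>L) =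
        (\<integral>\<^sup>+ G. (\<Sum>i\<in>nbrs (net_E G) 0. f (G, i, 0)) \<partial>L))"

text \<open>u(L;t) = 1/2 L[U_{mu_root}(x_{i->root}(t) : i in nbrs root)].\<close>
definition u_fun :: "net measure \<Rightarrow> real \<Rightarrow> ennreal" where
  "u_fun L t = ennreal (1/2) * (\<integral>\<^sup>+ G. ennreal (Umean (nbrs (net_E G) 0) (net_mu G 0)
        (\<lambda>i. xsol (net_E G) (net_mu G) t i 0)) \<partial>L)"

end

(*
  Rayleigh makes the cavity operator Gamma antitone, and size-increase makes t -> t Gamma(t x)
  non-decreasing and the expected size U strictly increasing in each weight. So the iterates of
  t Gamma from 0 enclose every other orbit between an increasing even and a decreasing odd
  subsequence, with limits satisfying upper = t Gamma(lower) and lower = t Gamma(upper), and a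
  globally attractive solution exists exactly when the two limits agree. Writing the solution as
  x(t) = t Gamma(t Gamma(x(t))), monotonicity in t yields the equation at infinite activity, and
  any solution y of the latter dominates all even iterates, hence the limit of x(t).

  On a unimodular network the occupation probability of an edge under the lower weights at one end
  equals the one under the upper weights at the other end. Mass transport therefore gives both
  families the same finite mean of U at the root; strict monotonicity forces them to coincide
  there, and unimodularity propagates this to all vertices. Since lower(t) is non-decreasing and
  upper(t)/t is non-increasing, rational activities suffice, so that x(t) exists for all t at once.
  The formula for m(L) is then monotone convergence.
*)
theory Submission
  imports Defs
begin

section \<open>Cavity-monotone measures\<close>

text \<open>A partition function is affine in every single weight, so all monotonicity in the
  weights reduces to signs of two-by-two determinants of its coefficients. The hypotheses give these
  signs for positive weights; a limit extends them to zero weights but loses strictness. Strictness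
  is used directly in two places: it gives singletons positive mass, hence keeps cavity ratios
  positive, and it lets equal mean sizes force equal weights, where the smaller weights are the
  positive lower solutions. Infinite weights are defined by truncation, whereas x(t) approaches its
  limit along another path. The bridge is that a bounded monotone function, continuous at finite
  weights, has the truncation limit along every approximation from below. On the unimodular side
  x(t) comes from a choice operator, so its measurability is not evident and integrals are computed
  with the lower solution instead. Each activity has its own exceptional null set, so only countably
  many can be handled together. Laws live on labelled representatives, so each test function for
  mass transport has to be shown invariant under relabelling.\<close>

lemma Zdel_eq_Zpart: "Zdel S mu e w = Zpart (S - {e}) mu w"
  by (simp add: Zdel_def Zpart_def)

lemma Zcon_eq_Zpart: "Zcon S mu e w = Zpart (S - {e}) (\<lambda>F. mu (insert e F)) w"
  by (simp add: Zcon_def Zpart_def)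

lemma cavity_ratio_eq_Zpart:
  "cavity_ratio S mu e w = Zpart (S - {e}) (\<lambda>F. mu (insert e F)) w / Zpart (S - {e}) mu w"
  by (simp add: cavity_ratio_def Zdel_eq_Zpart Zcon_eq_Zpart)

text \<open>The event is absorbed into the measure rather than into the index set, so that every
  quantity becomes a ratio of partition functions over one ground set and a single splitting rule
  serves them all.\<close>

lemma Prb_eq_Zpart:
  assumes "finite S"
  shows "Prb S mu w P = Zpart S (\<lambda>F. if P F then mu F else 0) w / Zpart S mu w"
proof -
  have "(\<Sum>F\<in>{F\<in>Pow S. P F}. mu F * prod w F) = Zpart S (\<lambda>F. if P F then mu F else 0) w"
    unfolding Zpart_def using assms by (subst sum.inter_filter) (auto intro!: sum.cong)
  then show ?thesis by (simp add: Prb_def)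
qed

lemma Exv_eq_Zpart: "Exv S mu w g = Zpart S (\<lambda>F. g F * mu F) w / Zpart S mu w"
  by (simp add: Exv_def Zpart_def)

lemma Umean_eq_Zpart: "Umean S mu w = Zpart S (\<lambda>F. real (card F) * mu F) w / Zpart S mu w"
  by (simp add: Umean_def Exv_eq_Zpart)

section \<open>Partition functions as multi-affine polynomials\<close>

lemma Zpart_cong:
  assumes "\<And>F. F \<subseteq> S \<Longrightarrow> mu F = mu' F" and "\<And>e. e \<in> S \<Longrightarrow> w e = w' e"
  shows "Zpart S mu w = Zpart S mu' w'"
  unfolding Zpart_def
proof (rule sum.cong)
  fix F assume "F \<in> Pow S"
  then have "prod w F = prod w' F" "mu F = mu' F" using assms by (auto intro: prod.cong)
  then show "mu F * prod w F = mu' F * prod w' F" by simp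
qed simp

lemma Zpart_zero [simp]: "Zpart S (\<lambda>F. 0) w = 0"
  by (simp add: Zpart_def)

lemma Zpart_add: "Zpart S (\<lambda>F. mu F + nu F) w = Zpart S mu w + Zpart S nu w"
  by (simp add: Zpart_def sum.distrib algebra_simps)

text \<open>Sorting the sets by whether they contain \<open>e\<close> shows the dependence on
  \<open>w e\<close> to be affine. The two coefficients are the deletion and the contraction at
  \<open>e\<close>.\<close>

lemma Zpart_split:
  assumes "finite S" and "e \<in> S"
  shows "Zpart S mu w = Zpart (S - {e}) mu w + w e * Zpart (S - {e}) (\<lambda>F. mu (insert e F)) w"
proof -
  let ?T = "S - {e}"
  have S: "S = insert e ?T" using assms by auto
  have "Pow S = Pow ?T \<union> insert e ` Pow ?T"
    by (subst S, subst Pow_insert) simp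
  moreover have "Pow ?T \<inter> insert e ` Pow ?T = {}" by auto
  moreover have "inj_on (insert e) (Pow ?T)" unfolding inj_on_def by blast
  moreover have "finite ?T" using assms by simp
  ultimately have "Zpart S mu w = (\<Sum>F\<in>Pow ?T. mu F * prod w F)
      + (\<Sum>F\<in>Pow ?T. mu (insert e F) * prod w (insert e F))"
    unfolding Zpart_def by (simp add: sum.union_disjoint sum.reindex)
  also have "(\<Sum>F\<in>Pow ?T. mu (insert e F) * prod w (insert e F))
      = (\<Sum>F\<in>Pow ?T. w e * (mu (insert e F) * prod w F))"
  proof (rule sum.cong)
    fix F assume "F \<in> Pow ?T"
    then have "finite F" "e \<notin> F" using \<open>finite ?T\<close> by (auto intro: finite_subset)
    then show "mu (insert e F) * prod w (insert e F) = w e * (mu (insert e F) * prod w F)" by simp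
  qed simp
  finally show ?thesis by (simp add: Zpart_def sum_distrib_left)
qed

lemma tendsto_Zpart:
  assumes "\<And>e. e \<in> S \<Longrightarrow> ((\<lambda>x. w x e) \<longlongrightarrow> l e) F"
  shows "((\<lambda>x. Zpart S mu (w x)) \<longlongrightarrow> Zpart S mu l) F"
  unfolding Zpart_def using assms
  by (intro tendsto_sum tendsto_mult tendsto_const tendsto_prod) auto

lemma Zpart_nonneg:
  assumes "\<And>F. F \<subseteq> S \<Longrightarrow> 0 \<le> mu F" and "\<And>e. e \<in> S \<Longrightarrow> 0 \<le> w e"
  shows "0 \<le> Zpart S mu w"
  unfolding Zpart_def using assms by (intro sum_nonneg mult_nonneg_nonneg prod_nonneg) auto

lemma Zpart_ge_empty:
  assumes "finite S" and "\<And>F. F \<subseteq> S \<Longrightarrow> 0 \<le> mu F" and "\<And>e. e \<in> S \<Longrightarrow> 0 \<le> w e"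
  shows "mu {} \<le> Zpart S mu w"
proof -
  have "(\<Sum>F\<in>{{}}. mu F * prod w F) \<le> Zpart S mu w"
    unfolding Zpart_def using assms
    by (intro sum_mono2 mult_nonneg_nonneg prod_nonneg) auto
  then show ?thesis by simp
qed

lemma Zpart_at_zero: "finite S \<Longrightarrow> Zpart S mu (\<lambda>_. 0) = mu {}"
proof -
  assume "finite S"
  then have "Zpart S mu (\<lambda>_. 0) = (\<Sum>F\<in>Pow S. if F = {} then mu F else 0)"
    unfolding Zpart_def by (intro sum.cong) (auto dest: finite_subset)
  with \<open>finite S\<close> show ?thesis by simp
qed

text \<open>Euler's identity: scaling all weights by \<open>t\<close> multiplies the term of
  \<open>F\<close> by \<open>t\<close> to the power \<open>card F\<close>.\<close>

lemma Zpart_scale_has_derivative: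
  assumes "finite S" and "0 < t"
  shows "((\<lambda>t. Zpart S mu (\<lambda>e. t * w e)) has_real_derivative
           Zpart S (\<lambda>F. real (card F) * mu F) (\<lambda>e. t * w e) / t) (at t)"
proof -
  have eq: "Zpart S nu (\<lambda>e. s * w e) = (\<Sum>F\<in>Pow S. nu F * s ^ card F * prod w F)" for nu s
    unfolding Zpart_def using assms
    by (intro sum.cong) (auto simp: prod.distrib dest: finite_subset)
  have "((\<lambda>t. \<Sum>F\<in>Pow S. mu F * t ^ card F * prod w F) has_real_derivative
      (\<Sum>F\<in>Pow S. mu F * (real (card F) * t ^ (card F - 1)) * prod w F)) (at t)"
    by (rule derivative_eq_intros refl)+ (simp add: algebra_simps)
  \<comment> \<open>For \<open>card F = 0\<close> the truncated exponent \<open>card F - 1\<close>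
    is harmless, since the factor \<open>card F\<close> annihilates both sides.\<close>
  moreover have "mu F * (real (card F) * t ^ (card F - 1)) * prod w F
      = real (card F) * mu F * t ^ card F * prod w F / t" for F
    using assms by (cases "card F") auto
  ultimately show ?thesis unfolding eq by (simp add: sum_divide_distrib)
qed

text \<open>Linearity of expectation before normalisation: the size is a sum of indicators, and the
  indicator of \<open>e\<close> keeps only the contracted part of the splitting at
  \<open>e\<close>.\<close>

lemma Zpart_card_eq:
  assumes "finite S"
  shows "Zpart S (\<lambda>F. real (card F) * mu F) w
       = (\<Sum>e\<in>S. w e * Zpart (S - {e}) (\<lambda>F. mu (insert e F)) w)"
proof -
  have "Zpart S (\<lambda>F. real (card F) * mu F) w
      = (\<Sum>F\<in>Pow S. \<Sum>e\<in>S. (if e \<in> F then mu F else 0) * prod w F)"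
    unfolding Zpart_def
  proof (rule sum.cong)
    fix F assume "F \<in> Pow S"
    then have "S \<inter> F = F" by auto
    then show "real (card F) * mu F * prod w F = (\<Sum>e\<in>S. (if e \<in> F then mu F else 0) * prod w F)"
      using assms by (simp add: if_distrib[of "\<lambda>c. c * _"] sum.If_cases flip: Int_def)
  qed simp
  also have "\<dots> = (\<Sum>e\<in>S. Zpart S (\<lambda>F. if e \<in> F then mu F else 0) w)"
    unfolding Zpart_def by (rule sum.swap)
  also have "\<dots> = (\<Sum>e\<in>S. w e * Zpart (S - {e}) (\<lambda>F. mu (insert e F)) w)"
  proof (rule sum.cong)
    fix e assume "e \<in> S"
    have "Zpart (S - {e}) (\<lambda>F. if e \<in> F then mu F else 0) w = Zpart (S - {e}) (\<lambda>F. 0) w"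
      by (rule Zpart_cong) auto
    with \<open>e \<in> S\<close> show "Zpart S (\<lambda>F. if e \<in> F then mu F else 0) w
        = w e * Zpart (S - {e}) (\<lambda>F. mu (insert e F)) w"
      using assms by (subst Zpart_split[of _ e]) auto
  qed simp
  finally show ?thesis .
qed

text \<open>The coordinates are raised one at a time, by induction on the set \<open>B\<close> of
  those already replaced; all intermediate points stay nonnegative. Monotonicity in several
  variables thus follows from a one-variable comparison.\<close>

lemma coordinatewise_mono:
  fixes g :: "('a \<Rightarrow> real) \<Rightarrow> real"
  assumes fin: "finite S"
    and cong: "\<And>w w'. (\<And>e. e \<in> S \<Longrightarrow> w e = w' e) \<Longrightarrow> g w = g w'"
    and step: "\<And>w f c. (\<And>e. e \<in> S \<Longrightarrow> 0 \<le> w e) \<Longrightarrow> f \<in> S \<Longrightarrow> w f \<le> c \<Longrightarrow> g w \<le> g (w(f := c))"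
    and le: "\<And>e. e \<in> S \<Longrightarrow> 0 \<le> w e" "\<And>e. e \<in> S \<Longrightarrow> w e \<le> w' e"
  shows "g w \<le> g w'"
proof -
  have "g w \<le> g (\<lambda>e. if e \<in> B then w' e else w e)" if "B \<subseteq> S" for B
    using finite_subset[OF that fin] that
  proof (induction B)
    case (insert f B)
    let ?v = "\<lambda>e. if e \<in> B then w' e else w e"
    have "g w \<le> g ?v" using insert by simp
    also have "\<dots> \<le> g (?v(f := w' f))"
    proof (rule step)
      show "0 \<le> ?v e" if "e \<in> S" for e using le[OF that] by simp
    qed (use insert le in auto)
    also have "?v(f := w' f) = (\<lambda>e. if e \<in> insert f B then w' e else w e)" by auto
    finally show ?case .
  qed simp
  from this[of S] have "g w \<le> g (\<lambda>e. if e \<in> S then w' e else w e)" by simp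
  also have "\<dots> = g w'" by (rule cong) simp
  finally show ?thesis .
qed

section \<open>Determinant inequalities and monotonicity in the weights\<close>

locale cavity_measure =
  fixes S :: "'a set" and mu :: "'a set \<Rightarrow> real"
  assumes cavity_monotone: "cavity_monotone S mu"
begin

lemma finite_S: "finite S" and mu_nonneg: "F \<subseteq> S \<Longrightarrow> 0 \<le> mu F" and mu_empty: "0 < mu {}"
  using cavity_monotone by (auto simp: cavity_monotone_def is_subset_measure_def)

lemma Zpart_pos:
  assumes "T \<subseteq> S" and "\<And>e. e \<in> T \<Longrightarrow> 0 \<le> w e"
  shows "0 < Zpart T mu w"
proof -
  have "mu {} \<le> Zpart T mu w"
    by (rule Zpart_ge_empty) (use assms finite_S mu_nonneg in \<open>auto intro: finite_subset\<close>)
  then show ?thesis using mu_empty by simp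
qed

text \<open>Splitting at both edges gives Z = C + w_f D + w_e (A + w_f B). After multiplication by
  Z^2 the Rayleigh inequality loses all terms except w_e w_f BC \<le> w_e w_f AD, so the weights of
  \<open>e\<close> and \<open>f\<close> themselves drop out.\<close>

lemma rayleigh_cross_pos:
  assumes "e \<in> S" "f \<in> S" "e \<noteq> f" and w: "\<And>k. k \<in> S \<Longrightarrow> 0 < w k"
  shows "Zpart (S - {e} - {f}) (\<lambda>F. mu (insert e (insert f F))) w * Zpart (S - {e} - {f}) mu w
     \<le> Zpart (S - {e} - {f}) (\<lambda>F. mu (insert e F)) w * Zpart (S - {e} - {f}) (\<lambda>F. mu (insert f F)) w"
proof -
  let ?T = "S - {e} - {f}"
  define A where "A = Zpart ?T (\<lambda>F. mu (insert e F)) w"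
  define B where "B = Zpart ?T (\<lambda>F. mu (insert e (insert f F))) w"
  define C where "C = Zpart ?T mu w"
  define D where "D = Zpart ?T (\<lambda>F. mu (insert f F)) w"
  have split: "Zpart S nu w = Zpart ?T nu w + w f * Zpart ?T (\<lambda>F. nu (insert f F)) w
      + w e * (Zpart ?T (\<lambda>F. nu (insert e F)) w + w f * Zpart ?T (\<lambda>F. nu (insert e (insert f F))) w)"
    for nu
    using assms finite_S by (simp add: Zpart_split[of S e] Zpart_split[of "S - {e}" f])
  have van: "Zpart ?T nu w = 0" if "\<And>F. e \<notin> F \<Longrightarrow> f \<notin> F \<Longrightarrow> nu F = 0" for nu
    by (rule trans[OF Zpart_cong Zpart_zero[of ?T w]]) (use that in auto)
  have Z: "Zpart S mu w = C + w f * D + w e * (A + w f * B)"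
    by (subst split) (simp add: A_def B_def C_def D_def)
  have Zef: "Zpart S (\<lambda>F. if e \<in> F \<and> f \<in> F then mu F else 0) w = w e * (w f * B)"
    using assms(3) by (subst split) (auto simp: van B_def)
  have Ze: "Zpart S (\<lambda>F. if e \<in> F then mu F else 0) w = w e * (A + w f * B)"
    using assms(3) by (subst split) (auto simp: van B_def A_def)
  have Zf: "Zpart S (\<lambda>F. if f \<in> F then mu F else 0) w = w f * D + w e * (w f * B)"
    using assms(3) by (subst split) (auto simp: van B_def D_def)
  have pos: "0 < Zpart S mu w" by (rule Zpart_pos) (use w in \<open>auto intro: less_imp_le\<close>)
  have we: "0 < w e" "0 < w f" using assms by auto
  have "Zpart S (\<lambda>F. if e \<in> F \<and> f \<in> F then mu F else 0) w / Zpart S mu w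
      \<le> Zpart S (\<lambda>F. if e \<in> F then mu F else 0) w / Zpart S mu w
        * (Zpart S (\<lambda>F. if f \<in> F then mu F else 0) w / Zpart S mu w)"
    using cavity_monotone assms
    by (auto simp: cavity_monotone_def rayleigh_def Prb_eq_Zpart[OF finite_S])
  then have "w e * (w f * B) * Zpart S mu w \<le> w e * (A + w f * B) * (w f * D + w e * (w f * B))"
    using pos by (simp add: Zef Ze Zf field_simps)
  then have "w e * w f * (B * C) \<le> w e * w f * (A * D)"
    unfolding Z by (simp add: algebra_simps)
  then have "B * C \<le> A * D" using we by simp
  then show ?thesis by (simp add: A_def B_def C_def D_def)
qed

text \<open>With Z = Z0 + w_e Z1 and N = N0 + w_e N1 the hypothesis reads N w_e Z1 < w_e N1 Z, and
  the term w_e^2 N1 Z1 cancels. What remains compares, in cross-multiplied form, the mean size given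
  that \<open>e\<close> is absent with the mean size given that it is present.\<close>

lemma size_cross_pos:
  assumes "e \<in> S" and w: "\<And>k. k \<in> S \<Longrightarrow> 0 < w k"
  shows "Zpart (S - {e}) (\<lambda>F. real (card F) * mu F) w * Zpart (S - {e}) (\<lambda>F. mu (insert e F)) w
     < Zpart (S - {e}) (\<lambda>F. real (card (insert e F)) * mu (insert e F)) w * Zpart (S - {e}) mu w"
proof -
  let ?T = "S - {e}"
  define N0 where "N0 = Zpart ?T (\<lambda>F. real (card F) * mu F) w"
  define N1 where "N1 = Zpart ?T (\<lambda>F. real (card (insert e F)) * mu (insert e F)) w"
  define Z0 where "Z0 = Zpart ?T mu w"
  define Z1 where "Z1 = Zpart ?T (\<lambda>F. mu (insert e F)) w"
  have van: "Zpart ?T nu w = 0" if "\<And>F. e \<notin> F \<Longrightarrow> nu F = 0" for nu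
    by (rule trans[OF Zpart_cong Zpart_zero[of ?T w]]) (use that in auto)
  note split = Zpart_split[OF finite_S assms(1)]
  have Z: "Zpart S mu w = Z0 + w e * Z1" by (subst split) (simp add: Z0_def Z1_def)
  have N: "Zpart S (\<lambda>F. real (card F) * mu F) w = N0 + w e * N1"
    by (subst split) (simp add: N0_def N1_def)
  have Ne: "Zpart S (\<lambda>F. real (card F) * (if e \<in> F then 1 else 0) * mu F) w = w e * N1"
    by (subst split) (auto simp: van N1_def)
  have Ze: "Zpart S (\<lambda>F. if e \<in> F then mu F else 0) w = w e * Z1"
    by (subst split) (auto simp: van Z1_def)
  have pos: "0 < Zpart S mu w" by (rule Zpart_pos) (use w in \<open>auto intro: less_imp_le\<close>)
  have frac: "x * y < z * Z" if "x / Z * (y / Z) < z / Z" and "0 < Z" for x y z Z :: real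
  proof -
    have "x / Z * (y / Z) * (Z * Z) < z / Z * (Z * Z)"
      using that by (intro mult_strict_right_mono) auto
    then show ?thesis using that by simp
  qed
  have "Zpart S (\<lambda>F. real (card F) * mu F) w / Zpart S mu w
        * (Zpart S (\<lambda>F. if e \<in> F then mu F else 0) w / Zpart S mu w)
      < Zpart S (\<lambda>F. real (card F) * (if e \<in> F then 1 else 0) * mu F) w / Zpart S mu w"
    using cavity_monotone assms
    by (auto simp: cavity_monotone_def size_increasing_def Prb_eq_Zpart[OF finite_S]
        Umean_eq_Zpart Exv_eq_Zpart)
  then have "(N0 + w e * N1) * (w e * Z1) < w e * N1 * Zpart S mu w"
    using pos unfolding N Ne Ze by (intro frac)
  then have "w e * (N0 * Z1) < w e * (N1 * Z0)"
    unfolding Z by (simp add: algebra_simps)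
  then have "N0 * Z1 < N1 * Z0" using w[OF assms(1)] by simp
  then show ?thesis by (simp add: N0_def N1_def Z0_def Z1_def)
qed

text \<open>Zero weights are reached by adding 1/(n+1) to every weight; the determinant inequalities
  pass to the limit, the strict one only as a weak one.\<close>

lemma perturb: "(\<lambda>n. w k + inverse (real (Suc n))) \<longlonglongrightarrow> w k"
  using tendsto_add[OF tendsto_const LIMSEQ_inverse_real_of_nat] by simp

lemma rayleigh_cross:
  assumes "e \<in> S" "f \<in> S" "e \<noteq> f" and w: "\<And>k. k \<in> S \<Longrightarrow> 0 \<le> w k"
  shows "Zpart (S - {e} - {f}) (\<lambda>F. mu (insert e (insert f F))) w * Zpart (S - {e} - {f}) mu w
     \<le> Zpart (S - {e} - {f}) (\<lambda>F. mu (insert e F)) w * Zpart (S - {e} - {f}) (\<lambda>F. mu (insert f F)) w"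
  by (rule LIMSEQ_le[OF tendsto_mult[OF tendsto_Zpart tendsto_Zpart]
        tendsto_mult[OF tendsto_Zpart tendsto_Zpart]])
     (use assms in \<open>auto intro!: perturb rayleigh_cross_pos add_nonneg_pos\<close>)

lemma size_cross:
  assumes "e \<in> S" and w: "\<And>k. k \<in> S \<Longrightarrow> 0 \<le> w k"
  shows "Zpart (S - {e}) (\<lambda>F. real (card F) * mu F) w * Zpart (S - {e}) (\<lambda>F. mu (insert e F)) w
     \<le> Zpart (S - {e}) (\<lambda>F. real (card (insert e F)) * mu (insert e F)) w * Zpart (S - {e}) mu w"
  by (rule LIMSEQ_le[OF tendsto_mult[OF tendsto_Zpart tendsto_Zpart]
        tendsto_mult[OF tendsto_Zpart tendsto_Zpart]])
     (use assms in \<open>auto intro!: perturb less_imp_le[OF size_cross_pos] add_nonneg_pos\<close>)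

text \<open>As a function of one weight x the ratio is (A + xB)/(C + xD), whose direction is decided
  by the sign of BC - AD. The sign is flipped throughout because \<open>coordinatewise_mono\<close>
  treats increasing functions.\<close>

lemma cavity_ratio_antimono:
  assumes e: "e \<in> S" and "\<And>k. k \<in> S - {e} \<Longrightarrow> 0 \<le> w k" and "\<And>k. k \<in> S - {e} \<Longrightarrow> w k \<le> w' k"
  shows "cavity_ratio S mu e w' \<le> cavity_ratio S mu e w"
proof -
  let ?T = "S - {e}"
  have "- cavity_ratio S mu e w \<le> - cavity_ratio S mu e w'"
  proof (rule coordinatewise_mono[of ?T "\<lambda>w. - cavity_ratio S mu e w"])
    show "- cavity_ratio S mu e v = - cavity_ratio S mu e v'" if "\<And>k. k \<in> ?T \<Longrightarrow> v k = v' k" for v v'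
      unfolding cavity_ratio_eq_Zpart using that
        Zpart_cong[of ?T mu mu v v'] Zpart_cong[of ?T "\<lambda>F. mu (insert e F)" _ v v'] by simp
  next
    fix v :: "'a \<Rightarrow> real" and f c assume v: "\<And>k. k \<in> ?T \<Longrightarrow> 0 \<le> v k" and f: "f \<in> ?T" and c: "v f \<le> c"
    let ?U = "?T - {f}"
    \<comment> \<open>\<open>rayleigh_cross\<close> asks for nonnegative weights on all of
      \<open>S\<close>, while \<open>v\<close> is controlled only off \<open>e\<close>; the value 0
      there leaves the partition functions over \<open>?U\<close> unchanged.\<close>
    let ?v = "v(e := 0)"
    define A where "A = Zpart ?U (\<lambda>F. mu (insert e F)) ?v"
    define B where "B = Zpart ?U (\<lambda>F. mu (insert e (insert f F))) ?v"
    define C where "C = Zpart ?U mu ?v"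
    define D where "D = Zpart ?U (\<lambda>F. mu (insert f F)) ?v"
    have split: "Zpart ?T nu u = Zpart ?U nu ?v + u f * Zpart ?U (\<lambda>F. nu (insert f F)) ?v"
      if "\<And>k. k \<in> ?U \<Longrightarrow> u k = v k" for nu u
    proof -
      have "Zpart ?U nu' u = Zpart ?U nu' ?v" for nu' by (rule Zpart_cong) (use that in auto)
      then show ?thesis using finite_S f by (subst Zpart_split[of _ f]) simp_all
    qed
    have ratio: "cavity_ratio S mu e u = (A + u f * B) / (C + u f * D)"
      and den: "0 < C + u f * D" if "\<And>k. k \<in> ?U \<Longrightarrow> u k = v k" "0 \<le> u f" for u
    proof -
      have sp: "Zpart ?T nu u = Zpart ?U nu ?v + u f * Zpart ?U (\<lambda>F. nu (insert f F)) ?v" for nu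
        by (rule split) (rule that(1))
      show "cavity_ratio S mu e u = (A + u f * B) / (C + u f * D)"
        unfolding cavity_ratio_eq_Zpart A_def B_def C_def D_def by (simp add: sp)
      have "0 < Zpart ?T mu u"
        by (rule Zpart_pos) (use that v f in force)+
      then show "0 < C + u f * D" unfolding C_def D_def by (simp add: sp)
    qed
    have c0: "0 \<le> c" using v[OF f] c by simp
    have "B * C \<le> A * D"
      unfolding A_def B_def C_def D_def using e f v by (intro rayleigh_cross) auto
    \<comment> \<open>For x = \<open>v f\<close> one has (A + cB)(C + xD) - (A + xB)(C + cD) = (c -
      x)(BC - AD).\<close>
    then have "(c - v f) * (B * C) \<le> (c - v f) * (A * D)"
      using c by (intro mult_left_mono) auto
    then have "(A + c * B) * (C + v f * D) \<le> (A + v f * B) * (C + c * D)"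
      by (simp add: algebra_simps)
    moreover have "0 < C + v f * D" by (rule den) (use v f in auto)
    moreover have "0 < C + (v(f := c)) f * D" by (rule den) (use f c0 in auto)
    ultimately have "(A + (v(f := c)) f * B) / (C + (v(f := c)) f * D) \<le> (A + v f * B) / (C + v f * D)"
      by (simp add: divide_simps mult.commute)
    also have "\<dots> = cavity_ratio S mu e v" by (rule ratio[symmetric]) (use v f in auto)
    also have "(A + (v(f := c)) f * B) / (C + (v(f := c)) f * D) = cavity_ratio S mu e (v(f := c))"
      by (rule ratio[symmetric]) (use f c0 in auto)
    finally have "cavity_ratio S mu e (v(f := c)) \<le> cavity_ratio S mu e v" .
    then show "- cavity_ratio S mu e v \<le> - cavity_ratio S mu e (v(f := c))" by simp
  qed (use assms finite_S in auto)
  then show ?thesis by simp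
qed

text \<open>Strict size increase excludes that \<open>e\<close> is never chosen, so the cavity ratio
  at unit weights is positive. By antitonicity the ratio at zero weights, which is
  \<open>mu {e} / mu {}\<close>, is at least as large.\<close>

lemma mu_singleton_pos:
  assumes "e \<in> S" shows "0 < mu {e}"
proof -
  let ?T = "S - {e}"
  have nn: "0 \<le> mu (insert e F)" if "F \<subseteq> ?T" for F by (rule mu_nonneg) (use that assms in auto)
  have fin: "finite ?T" using finite_S by simp
  have "Zpart ?T (\<lambda>F. mu (insert e F)) (\<lambda>_. 1) \<noteq> 0"
  proof
    assume *: "Zpart ?T (\<lambda>F. mu (insert e F)) (\<lambda>_. 1) = 0"
    then have "(\<Sum>F\<in>Pow ?T. mu (insert e F)) = 0" by (simp add: Zpart_def)
    then have "\<forall>F\<in>Pow ?T. mu (insert e F) = 0"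
      by (subst (asm) sum_nonneg_eq_0_iff) (use fin nn in auto)
    then have "Zpart ?T (\<lambda>F. real (card (insert e F)) * mu (insert e F)) (\<lambda>_. 1) = Zpart ?T (\<lambda>_. 0) (\<lambda>_. 1)"
      by (intro Zpart_cong) auto
    with size_cross_pos[OF assms, of "\<lambda>_. 1"] * show False by simp
  qed
  moreover have "0 \<le> Zpart ?T (\<lambda>F. mu (insert e F)) (\<lambda>_. 1)"
    by (rule Zpart_nonneg) (use nn in auto)
  moreover have "0 < Zpart ?T mu (\<lambda>_. 1)" by (rule Zpart_pos) auto
  ultimately have "0 < cavity_ratio S mu e (\<lambda>_. 1)" by (simp add: cavity_ratio_eq_Zpart)
  also have "\<dots> \<le> cavity_ratio S mu e (\<lambda>_. 0)"
    by (rule cavity_ratio_antimono) (use assms in auto)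
  also have "\<dots> = mu {e} / mu {}" using fin by (simp add: cavity_ratio_eq_Zpart Zpart_at_zero)
  finally show ?thesis using mu_empty by (simp add: zero_less_divide_iff)
qed

lemma Zcon_pos:
  assumes "e \<in> S" and "\<And>k. k \<in> S - {e} \<Longrightarrow> 0 \<le> w k"
  shows "0 < Zpart (S - {e}) (\<lambda>F. mu (insert e F)) w"
proof -
  have "mu (insert e {}) \<le> Zpart (S - {e}) (\<lambda>F. mu (insert e F)) w"
    by (rule Zpart_ge_empty) (use finite_S assms in \<open>auto intro!: mu_nonneg\<close>)
  then show ?thesis using mu_singleton_pos[OF assms(1)] by simp
qed

lemma cavity_ratio_pos:
  assumes "e \<in> S" and "\<And>k. k \<in> S - {e} \<Longrightarrow> 0 \<le> w k"
  shows "0 < cavity_ratio S mu e w"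
  unfolding cavity_ratio_eq_Zpart
  using Zcon_pos[OF assms] Zpart_pos[of "S - {e}" w] assms by auto

lemma tendsto_cavity_ratio:
  assumes "\<And>k. k \<in> S - {e} \<Longrightarrow> ((\<lambda>x. w x k) \<longlongrightarrow> l k) F" and "\<And>k. k \<in> S - {e} \<Longrightarrow> 0 \<le> l k"
  shows "((\<lambda>x. cavity_ratio S mu e (w x)) \<longlongrightarrow> cavity_ratio S mu e l) F"
proof -
  have "0 < Zpart (S - {e}) mu l" by (rule Zpart_pos) (use assms in auto)
  then show ?thesis unfolding cavity_ratio_eq_Zpart using assms
    by (intro tendsto_divide tendsto_Zpart) auto
qed

text \<open>The derivative of r Z1/Z0 has the sign of the mean size with \<open>e\<close> present
  minus the mean size with \<open>e\<close> absent, which \<open>size_cross\<close>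
  controls.\<close>

lemma scaled_cavity_ratio_mono:
  assumes e: "e \<in> S" and w: "\<And>k. k \<in> S - {e} \<Longrightarrow> 0 \<le> w k" and "0 < s" and "s \<le> t"
  shows "s * cavity_ratio S mu e (\<lambda>k. s * w k) \<le> t * cavity_ratio S mu e (\<lambda>k. t * w k)"
proof (rule DERIV_nonneg_imp_nondecreasing[OF \<open>s \<le> t\<close>])
  fix r assume "s \<le> r" "r \<le> t"
  with \<open>0 < s\<close> have r: "0 < r" by simp
  let ?T = "S - {e}"
  have fin: "finite ?T" using finite_S by simp
  define v where "v = (\<lambda>k. r * w k)"
  have v: "\<And>k. k \<in> ?T \<Longrightarrow> 0 \<le> v k" using w r by (simp add: v_def)
  define Z0 where "Z0 = Zpart ?T mu v"
  define Z1 where "Z1 = Zpart ?T (\<lambda>F. mu (insert e F)) v"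
  define N0 where "N0 = Zpart ?T (\<lambda>F. real (card F) * mu F) v"
  define M1 where "M1 = Zpart ?T (\<lambda>F. real (card F) * mu (insert e F)) v"
  have pos: "0 < Z0" unfolding Z0_def by (rule Zpart_pos) (use v in auto)
  \<comment> \<open>The extra \<open>Z1\<close> counts the edge \<open>e\<close> itself. It matches
    the contribution of the prefactor r to the derivative.\<close>
  have N1: "Zpart ?T (\<lambda>F. real (card (insert e F)) * mu (insert e F)) v = M1 + Z1"
  proof -
    have "Zpart ?T (\<lambda>F. real (card (insert e F)) * mu (insert e F)) v
        = Zpart ?T (\<lambda>F. real (card F) * mu (insert e F) + mu (insert e F)) v"
    proof (rule Zpart_cong)
      fix F assume "F \<subseteq> ?T"
      then have "finite F" "e \<notin> F" using fin by (auto intro: finite_subset)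
      then show "real (card (insert e F)) * mu (insert e F)
          = real (card F) * mu (insert e F) + mu (insert e F)"
        by (simp add: algebra_simps)
    qed simp
    then show ?thesis by (simp add: Zpart_add M1_def Z1_def)
  qed
  have cross: "N0 * Z1 \<le> (M1 + Z1) * Z0"
  proof -
    let ?v = "v(e := 0)"
    have cg: "Zpart ?T nu ?v = Zpart ?T nu v" for nu by (rule Zpart_cong) auto
    have "\<And>k. k \<in> S \<Longrightarrow> 0 \<le> ?v k" using v by auto
    from size_cross[of e ?v, OF e this] show ?thesis
      unfolding cg N1 by (simp add: N0_def Z0_def Z1_def)
  qed
  let ?d = "((1 * Z1 + r * (M1 / r)) * Z0 - r * Z1 * (N0 / r)) / (Z0 * Z0)"
  have d1: "((\<lambda>r. Zpart ?T (\<lambda>F. mu (insert e F)) (\<lambda>k. r * w k)) has_real_derivative M1 / r) (at r)"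
    unfolding M1_def v_def by (rule Zpart_scale_has_derivative[OF fin r])
  have d0: "((\<lambda>r. Zpart ?T mu (\<lambda>k. r * w k)) has_real_derivative N0 / r) (at r)"
    unfolding N0_def v_def by (rule Zpart_scale_has_derivative[OF fin r])
  have "((\<lambda>r. r * Zpart ?T (\<lambda>F. mu (insert e F)) (\<lambda>k. r * w k) / Zpart ?T mu (\<lambda>k. r * w k))
      has_real_derivative ?d) (at r)"
    using DERIV_divide[OF DERIV_mult[OF DERIV_ident d1] d0] pos
    by (simp add: Z0_def Z1_def v_def algebra_simps)
  then have "((\<lambda>r. r * cavity_ratio S mu e (\<lambda>k. r * w k)) has_real_derivative ?d) (at r)"
    by (simp add: cavity_ratio_eq_Zpart)
  moreover have "0 \<le> ?d"
    using cross pos r by (intro divide_nonneg_nonneg) (auto simp: algebra_simps)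
  ultimately show "\<exists>y. ((\<lambda>r. r * cavity_ratio S mu e (\<lambda>k. r * w k)) has_real_derivative y) (at r) \<and> 0 \<le> y"
    by blast
qed

lemma Umean_cong: "(\<And>k. k \<in> S \<Longrightarrow> w k = w' k) \<Longrightarrow> Umean S mu w = Umean S mu w'"
  unfolding Umean_eq_Zpart
  using Zpart_cong[of S mu mu w w'] Zpart_cong[of S "\<lambda>F. real (card F) * mu F" _ w w'] by simp

text \<open>In the weight x of \<open>f\<close> the mean size is (N0 + x N1)/(Z0 + x Z1), with
  determinant N1 Z0 - N0 Z1. The strict version asks for positive weights, where the determinant is
  strictly positive.\<close>

lemma Umean_step:
  assumes v: "\<And>k. k \<in> S \<Longrightarrow> 0 \<le> v k" and f: "f \<in> S" and c: "v f \<le> c"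
  shows "Umean S mu v \<le> Umean S mu (v(f := c))"
    and "(\<And>k. k \<in> S \<Longrightarrow> 0 < v k) \<Longrightarrow> v f < c \<Longrightarrow> Umean S mu v < Umean S mu (v(f := c))"
proof -
  let ?T = "S - {f}"
  define Z0 where "Z0 = Zpart ?T mu v"
  define Z1 where "Z1 = Zpart ?T (\<lambda>F. mu (insert f F)) v"
  define N0 where "N0 = Zpart ?T (\<lambda>F. real (card F) * mu F) v"
  define N1 where "N1 = Zpart ?T (\<lambda>F. real (card (insert f F)) * mu (insert f F)) v"
  have cg: "Zpart ?T nu (v(f := c)) = Zpart ?T nu v" for nu by (rule Zpart_cong) auto
  note split = Zpart_split[OF finite_S f]
  have U: "Umean S mu v = (N0 + v f * N1) / (Z0 + v f * Z1)"
    "Umean S mu (v(f := c)) = (N0 + c * N1) / (Z0 + c * Z1)"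
    unfolding Umean_eq_Zpart split[of _ v] split[of _ "v(f := c)"]
    by (simp_all add: cg N0_def N1_def Z0_def Z1_def)
  have "0 < Zpart S mu v" by (rule Zpart_pos) (use v in auto)
  then have p: "0 < Z0 + v f * Z1" unfolding split[of _ v] by (simp add: Z0_def Z1_def)
  have "0 < Zpart S mu (v(f := c))"
    by (rule Zpart_pos) (use v f c in \<open>auto intro: order_trans[of 0 "v f"]\<close>)
  then have q: "0 < Z0 + c * Z1" unfolding split[of _ "v(f := c)"] by (simp add: Z0_def Z1_def cg)
  have "N0 * Z1 \<le> N1 * Z0"
    unfolding N0_def N1_def Z0_def Z1_def by (rule size_cross[OF f]) (use v in auto)
  then have "(c - v f) * (N0 * Z1) \<le> (c - v f) * (N1 * Z0)" using c by (intro mult_left_mono) auto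
  then have "(N0 + v f * N1) * (Z0 + c * Z1) \<le> (N0 + c * N1) * (Z0 + v f * Z1)"
    by (simp add: algebra_simps)
  then show "Umean S mu v \<le> Umean S mu (v(f := c))"
    unfolding U using p q by (simp add: divide_simps mult.commute)
  assume pos: "\<And>k. k \<in> S \<Longrightarrow> 0 < v k" and "v f < c"
  have "N0 * Z1 < N1 * Z0"
    unfolding N0_def N1_def Z0_def Z1_def by (rule size_cross_pos[OF f]) (use pos in auto)
  then have "(c - v f) * (N0 * Z1) < (c - v f) * (N1 * Z0)" using \<open>v f < c\<close> by simp
  then have "(N0 + v f * N1) * (Z0 + c * Z1) < (N0 + c * N1) * (Z0 + v f * Z1)"
    by (simp add: algebra_simps)
  then show "Umean S mu v < Umean S mu (v(f := c))"
    unfolding U using p q by (simp add: divide_simps mult.commute)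
qed

lemma Umean_mono:
  assumes "\<And>k. k \<in> S \<Longrightarrow> 0 \<le> w k" and "\<And>k. k \<in> S \<Longrightarrow> w k \<le> w' k"
  shows "Umean S mu w \<le> Umean S mu w'"
  by (rule coordinatewise_mono[of S "Umean S mu"])
     (use assms finite_S in \<open>auto intro: Umean_cong Umean_step(1)\<close>)

text \<open>Raising one differing coordinate alone already increases the mean strictly, and the
  remaining coordinates cannot undo this. It turns an equality of averages into an equality of
  weights.\<close>

lemma Umean_eq_imp_eq:
  assumes pos: "\<And>k. k \<in> S \<Longrightarrow> 0 < w k" and le: "\<And>k. k \<in> S \<Longrightarrow> w k \<le> w' k"
    and eq: "Umean S mu w = Umean S mu w'" and "f \<in> S"
  shows "w f = w' f"
proof (rule ccontr)
  assume "w f \<noteq> w' f"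
  with le[OF \<open>f \<in> S\<close>] have "w f < w' f" by simp
  then have "Umean S mu w < Umean S mu (w(f := w' f))"
    using pos \<open>f \<in> S\<close> by (intro Umean_step(2)) (auto intro: less_imp_le)
  also have "\<dots> \<le> Umean S mu w'"
    by (rule Umean_mono) (use pos le \<open>f \<in> S\<close> in \<open>auto intro: less_imp_le order_trans[OF less_imp_le]\<close>)
  finally show False using eq by simp
qed

lemma tendsto_Umean:
  assumes "\<And>k. k \<in> S \<Longrightarrow> ((\<lambda>x. w x k) \<longlongrightarrow> l k) F" and "\<And>k. k \<in> S \<Longrightarrow> 0 \<le> l k"
  shows "((\<lambda>x. Umean S mu (w x)) \<longlongrightarrow> Umean S mu l) F"
proof -
  have "0 < Zpart S mu l" by (rule Zpart_pos) (use assms in auto)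
  then show ?thesis unfolding Umean_eq_Zpart using assms
    by (intro tendsto_divide tendsto_Zpart) auto
qed

lemma Umean_nonneg:
  assumes "\<And>k. k \<in> S \<Longrightarrow> 0 \<le> w k"
  shows "0 \<le> Umean S mu w"
  unfolding Umean_eq_Zpart using assms mu_nonneg
  by (intro divide_nonneg_nonneg Zpart_nonneg) auto

text \<open>The bound is uniform in the weights: it makes truncations converge and, under an
  integrable rank, gives the mean sizes at the root a finite expectation.\<close>

lemma Umean_le_rank:
  assumes w: "\<And>k. k \<in> S \<Longrightarrow> 0 \<le> w k"
  shows "Umean S mu w \<le> real (rank_meas S mu)"
proof -
  have "Zpart S (\<lambda>F. real (card F) * mu F) w \<le> real (rank_meas S mu) * Zpart S mu w"
    unfolding Zpart_def sum_distrib_left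
  proof (rule sum_mono)
    fix F assume "F \<in> Pow S"
    then have F: "F \<subseteq> S" by simp
    have "real (card F) * mu F \<le> real (rank_meas S mu) * mu F"
    proof (cases "mu F = 0")
      case False
      with mu_nonneg[OF F] have "0 < mu F" by simp
      moreover have "finite {card F |F. F \<subseteq> S \<and> 0 < mu F}" using finite_S by simp
      ultimately have "card F \<le> rank_meas S mu"
        unfolding rank_meas_def using F by (intro Max_ge) auto
      with \<open>0 < mu F\<close> show ?thesis by simp
    qed simp
    moreover have "0 \<le> prod w F" using F w by (intro prod_nonneg) auto
    ultimately show "real (card F) * mu F * prod w F \<le> real (rank_meas S mu) * (mu F * prod w F)"
      by (simp add: mult_right_mono flip: mult.assoc)
  qed
  moreover have "0 < Zpart S mu w" by (rule Zpart_pos) (use w in auto)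
  ultimately show ?thesis unfolding Umean_eq_Zpart by (simp add: divide_simps)
qed

text \<open>Since Z is Zdel times 1 + w_e \<Gamma>, the edge \<open>e\<close> is occupied with
  probability w_e \<Gamma> / (1 + w_e \<Gamma>). In this form the mean size at a vertex involves
  only the two messages on each incident edge.\<close>

lemma Umean_eq_sum_cavity:
  assumes "\<And>k. k \<in> S \<Longrightarrow> 0 \<le> w k"
  shows "Umean S mu w = (\<Sum>e\<in>S. w e * cavity_ratio S mu e w / (1 + w e * cavity_ratio S mu e w))"
proof -
  have "Umean S mu w = (\<Sum>e\<in>S. w e * Zpart (S - {e}) (\<lambda>F. mu (insert e F)) w / Zpart S mu w)"
    unfolding Umean_eq_Zpart Zpart_card_eq[OF finite_S] by (simp add: sum_divide_distrib)
  also have "\<dots> = (\<Sum>e\<in>S. w e * cavity_ratio S mu e w / (1 + w e * cavity_ratio S mu e w))"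
  proof (rule sum.cong)
    fix e assume e: "e \<in> S"
    have "0 < Zpart (S - {e}) mu w" by (rule Zpart_pos) (use assms in auto)
    then show "w e * Zpart (S - {e}) (\<lambda>F. mu (insert e F)) w / Zpart S mu w
        = w e * cavity_ratio S mu e w / (1 + w e * cavity_ratio S mu e w)"
      unfolding cavity_ratio_eq_Zpart Zpart_split[OF finite_S e, of mu]
      by (simp add: field_simps)
  qed simp
  finally show ?thesis .
qed

end

subsection \<open>Weights with infinite entries\<close>

text \<open>This names the expression under the limits that define \<open>Uext\<close> and
  \<open>Gamma_ext\<close>.\<close>

definition truncate :: "('a \<Rightarrow> ereal) \<Rightarrow> nat \<Rightarrow> 'a \<Rightarrow> real" where
  "truncate y n = (\<lambda>e. real_of_ereal (min (y e) (ereal (real n))))"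

lemma ereal_truncate: "0 \<le> y e \<Longrightarrow> ereal (truncate y n e) = min (y e) (ereal (real n))"
  unfolding truncate_def by (cases "y e") (auto simp: min_def)

lemma truncate_nonneg: "0 \<le> y e \<Longrightarrow> 0 \<le> truncate y n e"
  unfolding truncate_def by (cases "y e") (auto simp: min_def)

lemma truncate_mono: "0 \<le> y e \<Longrightarrow> m \<le> n \<Longrightarrow> truncate y m e \<le> truncate y n e"
  unfolding truncate_def by (cases "y e") (auto simp: min_def)

lemma le_truncate: "ereal x \<le> y e \<Longrightarrow> 0 \<le> y e \<Longrightarrow> x \<le> real n \<Longrightarrow> x \<le> truncate y n e"
  unfolding truncate_def by (cases "y e") (auto simp: min_def)

lemma tendsto_min_truncate:
  assumes "0 \<le> y e" and "((\<lambda>x. ereal (X x)) \<longlongrightarrow> y e) F"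
  shows "((\<lambda>x. min (X x) (real n)) \<longlongrightarrow> truncate y n e) F"
proof -
  have "((\<lambda>x. min (ereal (X x)) (ereal (real n))) \<longlongrightarrow> min (y e) (ereal (real n))) F"
    by (intro tendsto_min assms tendsto_const)
  then have "((\<lambda>x. ereal (min (X x) (real n))) \<longlongrightarrow> ereal (truncate y n e)) F"
    by (simp only: ereal_truncate[of y e, OF assms(1)] ereal_min)
  then show ?thesis by (simp only: lim_ereal)
qed

section \<open>Continuity from below at infinite weights\<close>

context
  fixes S :: "'a set" and g :: "('a \<Rightarrow> real) \<Rightarrow> real" and y :: "'a \<Rightarrow> ereal" and C :: real
  assumes fin: "finite S"
    and y: "\<And>e. e \<in> S \<Longrightarrow> 0 \<le> y e"
    and mono: "\<And>w w'. (\<And>e. e \<in> S \<Longrightarrow> 0 \<le> w e) \<Longrightarrow> (\<And>e. e \<in> S \<Longrightarrow> w e \<le> w' e) \<Longrightarrow> g w \<le> g w'"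
    and bound: "\<And>w. (\<And>e. e \<in> S \<Longrightarrow> 0 \<le> w e) \<Longrightarrow> g w \<le> C"
begin

lemma truncation_tendsto: "(\<lambda>n. g (truncate y n)) \<longlonglongrightarrow> lim (\<lambda>n. g (truncate y n))"
proof -
  have "incseq (\<lambda>n. g (truncate y n))"
    by (auto intro!: incseq_SucI mono truncate_mono truncate_nonneg y)
  moreover have "\<forall>n. g (truncate y n) \<le> C" by (auto intro!: bound truncate_nonneg y)
  ultimately obtain L where "(\<lambda>n. g (truncate y n)) \<longlonglongrightarrow> L" by (rule incseq_convergent)
  then show ?thesis by (simp add: limI)
qed

lemma truncation_le: "g (truncate y n) \<le> lim (\<lambda>n. g (truncate y n))"
  by (rule incseq_le[OF _ truncation_tendsto])
     (auto intro!: incseq_SucI mono truncate_mono truncate_nonneg y)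

lemma le_truncation_lim:
  assumes "\<And>e. e \<in> S \<Longrightarrow> 0 \<le> w e" and "\<And>e. e \<in> S \<Longrightarrow> ereal (w e) \<le> y e"
  shows "g w \<le> lim (\<lambda>n. g (truncate y n))"
proof -
  \<comment> \<open>The sum of the weights dominates each of them, so one truncation level serves
    all coordinates.\<close>
  obtain n :: nat where "(\<Sum>e\<in>S. w e) \<le> real n" using real_arch_simple by blast
  then have "w e \<le> real n" if "e \<in> S" for e
    using member_le_sum[OF that, of w] assms(1) fin by auto
  then have "g w \<le> g (truncate y n)"
    using assms y by (intro mono le_truncate) auto
  then show ?thesis using truncation_le order_trans by blast
qed

text \<open>From below: cutting \<open>X x\<close> at level \<open>n\<close> gives weights that
  converge to \<open>truncate y n\<close>, where \<open>g\<close> is continuous, and cutting only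
  decreases \<open>g\<close>. From above: \<open>le_truncation_lim\<close> bounds every finite
  configuration under \<open>y\<close>.\<close>

lemma tendsto_truncation_lim:
  assumes cont: "\<And>w l. (\<And>e. e \<in> S \<Longrightarrow> ((\<lambda>x. w x e) \<longlongrightarrow> l e) F) \<Longrightarrow> (\<And>e. e \<in> S \<Longrightarrow> 0 \<le> l e)
      \<Longrightarrow> ((\<lambda>x. g (w x)) \<longlongrightarrow> g l) F"
    and X: "\<forall>\<^sub>F x in F. \<forall>e\<in>S. 0 \<le> X x e \<and> ereal (X x e) \<le> y e"
    and lim: "\<And>e. e \<in> S \<Longrightarrow> ((\<lambda>x. ereal (X x e)) \<longlongrightarrow> y e) F"
  shows "((\<lambda>x. g (X x)) \<longlongrightarrow> lim (\<lambda>n. g (truncate y n))) F"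
proof (rule order_tendstoI)
  fix a assume "a < lim (\<lambda>n. g (truncate y n))"
  with truncation_tendsto have "\<forall>\<^sub>F n in sequentially. a < g (truncate y n)"
    by (simp add: order_tendsto_iff)
  then obtain n where n: "a < g (truncate y n)" by (auto simp: eventually_sequentially)
  have "((\<lambda>x. g (\<lambda>e. min (X x e) (real n))) \<longlongrightarrow> g (truncate y n)) F"
    by (rule cont) (auto intro!: tendsto_min_truncate lim y truncate_nonneg)
  with n have "\<forall>\<^sub>F x in F. a < g (\<lambda>e. min (X x e) (real n))"
    by (simp add: order_tendsto_iff)
  with X show "\<forall>\<^sub>F x in F. a < g (X x)"
  proof eventually_elim
    case (elim x)
    then have "g (\<lambda>e. min (X x e) (real n)) \<le> g (X x)" by (intro mono) auto
    with elim show ?case by simp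
  qed
next
  fix a assume "lim (\<lambda>n. g (truncate y n)) < a"
  with X show "\<forall>\<^sub>F x in F. g (X x) < a"
    by (elim eventually_mono) (auto intro: le_less_trans[OF le_truncation_lim])
qed

end

lemma mono_tendsto_SUP_at_top:
  fixes f :: "real \<Rightarrow> ereal"
  assumes "\<And>s t. a < s \<Longrightarrow> s \<le> t \<Longrightarrow> f s \<le> f t"
  shows "(f \<longlongrightarrow> (SUP t\<in>{a<..}. f t)) at_top"
proof (rule order_tendstoI)
  fix c assume "c < (SUP t\<in>{a<..}. f t)"
  then obtain s where s: "a < s" "c < f s" by (auto simp: less_SUP_iff)
  show "\<forall>\<^sub>F t in at_top. c < f t"
    using eventually_ge_at_top[of s] by eventually_elim (use s assms in \<open>auto intro: less_le_trans\<close>)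
next
  fix c assume c: "(SUP t\<in>{a<..}. f t) < c"
  show "\<forall>\<^sub>F t in at_top. f t < c"
    using eventually_gt_at_top[of a]
    by eventually_elim (rule le_less_trans[OF SUP_upper c], simp)
qed

lemma LIMSEQ_even_odd:
  fixes f :: "nat \<Rightarrow> real"
  assumes "(\<lambda>n. f (2 * n)) \<longlonglongrightarrow> l" and "(\<lambda>n. f (Suc (2 * n))) \<longlonglongrightarrow> l"
  shows "f \<longlonglongrightarrow> l"
proof (rule LIMSEQ_I)
  fix r :: real assume r: "0 < r"
  from LIMSEQ_D[OF assms(1) r] obtain a where a: "\<And>n. a \<le> n \<Longrightarrow> norm (f (2 * n) - l) < r" by blast
  from LIMSEQ_D[OF assms(2) r] obtain b where b: "\<And>n. b \<le> n \<Longrightarrow> norm (f (Suc (2 * n)) - l) < r" by blast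
  have "norm (f n - l) < r" if "n \<ge> Suc (2 * (a + b))" for n
  proof (cases "even n")
    case True
    then obtain k where "n = 2 * k" by blast
    then show ?thesis using a[of k] that by simp
  next
    case False
    then obtain k where "n = Suc (2 * k)" by (elim oddE) auto
    then show ?thesis using b[of k] that by simp
  qed
  then show "\<exists>N. \<forall>n\<ge>N. norm (f n - l) < r" by blast
qed

context cavity_measure
begin

text \<open>The ratio decreases in the weights, so the preceding results are applied to its
  negative, which is bounded above by 0.\<close>

lemma cavity_ratio_truncation:
  assumes e: "e \<in> S" and y: "\<And>k. k \<in> S - {e} \<Longrightarrow> 0 \<le> y k"
  defines "L \<equiv> lim (\<lambda>n. cavity_ratio S mu e (truncate y n))"
  shows "0 \<le> L"
    and "(\<And>k. k \<in> S - {e} \<Longrightarrow> 0 \<le> w k) \<Longrightarrow> (\<And>k. k \<in> S - {e} \<Longrightarrow> ereal (w k) \<le> y k)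
      \<Longrightarrow> L \<le> cavity_ratio S mu e w"
    and "\<forall>\<^sub>F x in F. \<forall>k\<in>S - {e}. 0 \<le> X x k \<and> ereal (X x k) \<le> y k
      \<Longrightarrow> (\<And>k. k \<in> S - {e} \<Longrightarrow> ((\<lambda>x. ereal (X x k)) \<longlongrightarrow> y k) F)
      \<Longrightarrow> ((\<lambda>x. cavity_ratio S mu e (X x)) \<longlongrightarrow> L) F"
proof -
  let ?T = "S - {e}"
  let ?g = "\<lambda>w. - cavity_ratio S mu e w"
  have fin: "finite ?T" using finite_S by simp
  have mono: "?g w \<le> ?g w'" if "\<And>k. k \<in> ?T \<Longrightarrow> 0 \<le> w k" "\<And>k. k \<in> ?T \<Longrightarrow> w k \<le> w' k" for w w'
    using cavity_ratio_antimono[OF e that] by simp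
  have bound: "?g w \<le> 0" if "\<And>k. k \<in> ?T \<Longrightarrow> 0 \<le> w k" for w
    using cavity_ratio_pos[of e w, OF e that] by simp
  note * = fin y mono bound
  have "(\<lambda>n. - ?g (truncate y n)) \<longlonglongrightarrow> - lim (\<lambda>n. ?g (truncate y n))"
    by (intro tendsto_minus truncation_tendsto[of ?T y ?g 0]) (use * in auto)
  then have L: "L = - lim (\<lambda>n. ?g (truncate y n))" unfolding L_def by (intro limI) simp
  have neg: "?g (truncate y n) \<le> 0" for n by (rule bound) (intro truncate_nonneg y)
  have "lim (\<lambda>n. ?g (truncate y n)) \<le> 0"
    by (rule LIMSEQ_le_const2[OF truncation_tendsto[of ?T y ?g 0]])
       (use * neg in auto)
  then show "0 \<le> L" using L by simp
  show "L \<le> cavity_ratio S mu e w"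
    if "\<And>k. k \<in> S - {e} \<Longrightarrow> 0 \<le> w k" "\<And>k. k \<in> S - {e} \<Longrightarrow> ereal (w k) \<le> y k"
    using le_truncation_lim[of ?T y ?g, OF * that] L by simp
  show "((\<lambda>x. cavity_ratio S mu e (X x)) \<longlongrightarrow> L) F"
    if X: "\<forall>\<^sub>F x in F. \<forall>k\<in>S - {e}. 0 \<le> X x k \<and> ereal (X x k) \<le> y k"
      and lim: "\<And>k. k \<in> S - {e} \<Longrightarrow> ((\<lambda>x. ereal (X x k)) \<longlongrightarrow> y k) F"
  proof -
    have "((\<lambda>x. ?g (X x)) \<longlongrightarrow> lim (\<lambda>n. ?g (truncate y n))) F"
      by (rule tendsto_truncation_lim[of ?T y ?g, OF *])
         (use X lim in \<open>auto intro!: tendsto_minus tendsto_cavity_ratio\<close>)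
    from tendsto_minus[OF this] show ?thesis by (simp add: L)
  qed
qed

lemma Umean_truncation:
  assumes y: "\<And>k. k \<in> S \<Longrightarrow> 0 \<le> y k"
    and X: "\<forall>\<^sub>F x in F. \<forall>k\<in>S. 0 \<le> X x k \<and> ereal (X x k) \<le> y k"
    and lim: "\<And>k. k \<in> S \<Longrightarrow> ((\<lambda>x. ereal (X x k)) \<longlongrightarrow> y k) F"
  shows "((\<lambda>x. Umean S mu (X x)) \<longlongrightarrow> Uext S mu y) F"
  unfolding Uext_def truncate_def[symmetric]
  by (rule tendsto_truncation_lim[of S y "Umean S mu" "real (rank_meas S mu)"])
     (use assms in \<open>auto intro!: finite_S Umean_mono Umean_le_rank tendsto_Umean\<close>)

end

section \<open>Extremal solutions of the cavity equation\<close>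

definition cavity_iter :: "('v \<Rightarrow> 'v \<Rightarrow> bool) \<Rightarrow> ('v \<Rightarrow> 'v set \<Rightarrow> real) \<Rightarrow> real \<Rightarrow> nat \<Rightarrow> 'v \<Rightarrow> 'v \<Rightarrow> real" where
  "cavity_iter E mu t n = (cavity_step t E mu ^^ n) (\<lambda>_ _. 0)"

definition lower_sol :: "('v \<Rightarrow> 'v \<Rightarrow> bool) \<Rightarrow> ('v \<Rightarrow> 'v set \<Rightarrow> real) \<Rightarrow> real \<Rightarrow> 'v \<Rightarrow> 'v \<Rightarrow> real" where
  "lower_sol E mu t i j = lim (\<lambda>n. cavity_iter E mu t (2 * n) i j)"

definition upper_sol :: "('v \<Rightarrow> 'v \<Rightarrow> bool) \<Rightarrow> ('v \<Rightarrow> 'v set \<Rightarrow> real) \<Rightarrow> real \<Rightarrow> 'v \<Rightarrow> 'v \<Rightarrow> real" where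
  "upper_sol E mu t i j = lim (\<lambda>n. cavity_iter E mu t (Suc (2 * n)) i j)"

lemma cavity_iter_0 [simp]: "cavity_iter E mu t 0 i j = 0"
  by (simp add: cavity_iter_def)

lemma cavity_iter_Suc: "cavity_iter E mu t (Suc n) i j = t * GammaN E mu (cavity_iter E mu t n) i j"
  by (simp add: cavity_iter_def cavity_step_def)

lemma cavity_step_apply: "cavity_step t E mu x i j = t * GammaN E mu x i j"
  by (simp add: cavity_step_def)

lemma cavity_step_funpow_Suc:
  "(cavity_step t E mu ^^ Suc n) x i j = t * GammaN E mu ((cavity_step t E mu ^^ n) x) i j"
  by (simp only: funpow.simps comp_def cavity_step_apply)

section \<open>Iterates of the antitone cavity operator\<close>

locale cavity_network =
  fixes V :: "'v set" and E :: "'v \<Rightarrow> 'v \<Rightarrow> bool" and mu :: "'v \<Rightarrow> 'v set \<Rightarrow> real"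
  assumes cm_network: "cm_network V E mu"
begin

lemma E_sym: "E i j \<Longrightarrow> E j i" and E_in_V: "E i j \<Longrightarrow> i \<in> V"
  using cm_network by (auto simp: cm_network_def network_def)

lemma cavity_measure_at: "i \<in> V \<Longrightarrow> cavity_measure (nbrs E i) (mu i)"
  using cm_network by (auto simp: cm_network_def cavity_measure_def)

lemma cavity_measure_edge: "E i j \<Longrightarrow> cavity_measure (nbrs E i) (mu i)"
  by (rule cavity_measure_at[OF E_in_V])

lemma nbrs_sym: "k \<in> nbrs E i \<Longrightarrow> E k i"
  by (auto simp: nbrs_def intro: E_sym)

lemma GammaN_antimono:
  assumes "E i j" and "\<And>k. E k i \<Longrightarrow> 0 \<le> x k i" and "\<And>k. E k i \<Longrightarrow> x k i \<le> y k i"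
  shows "GammaN E mu y i j \<le> GammaN E mu x i j"
  unfolding GammaN_def using assms
  by (intro cavity_measure.cavity_ratio_antimono[OF cavity_measure_edge]) (auto dest: nbrs_sym simp: nbrs_def E_sym)

lemma GammaN_pos:
  assumes "E i j" and "\<And>k. E k i \<Longrightarrow> 0 \<le> x k i"
  shows "0 < GammaN E mu x i j"
  unfolding GammaN_def using assms
  by (intro cavity_measure.cavity_ratio_pos[OF cavity_measure_edge]) (auto simp: nbrs_def E_sym)

lemma tendsto_GammaN:
  assumes "E i j" and "\<And>k. E k i \<Longrightarrow> ((\<lambda>n. x n k i) \<longlongrightarrow> l k i) F" and "\<And>k. E k i \<Longrightarrow> 0 \<le> l k i"
  shows "((\<lambda>n. GammaN E mu (x n) i j) \<longlongrightarrow> GammaN E mu l i j) F"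
  unfolding GammaN_def using assms
  by (intro cavity_measure.tendsto_cavity_ratio[OF cavity_measure_edge]) (auto simp: nbrs_def E_sym)

lemma scaled_GammaN_mono:
  assumes "E i j" and "\<And>k. E k i \<Longrightarrow> 0 \<le> x k i" and "0 < s" and "s \<le> t"
  shows "s * GammaN E mu (\<lambda>k l. s * x k l) i j \<le> t * GammaN E mu (\<lambda>k l. t * x k l) i j"
  unfolding GammaN_def using assms
  by (intro cavity_measure.scaled_cavity_ratio_mono[OF cavity_measure_edge]) (auto simp: nbrs_def E_sym)

lemma cavity_step_funpow_nonneg:
  assumes "is_config E x" and "0 < t" and "E i j"
  shows "0 \<le> (cavity_step t E mu ^^ n) x i j"
  using assms(3)
proof (induction n arbitrary: i j)
  case 0 then show ?case using assms by (simp add: is_config_def)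
next
  case (Suc n)
  then have "0 < GammaN E mu ((cavity_step t E mu ^^ n) x) i j" by (intro GammaN_pos)
  then show ?case unfolding cavity_step_funpow_Suc using assms by simp
qed

lemma cavity_iter_nonneg: "0 < t \<Longrightarrow> E i j \<Longrightarrow> 0 \<le> cavity_iter E mu t n i j"
  unfolding cavity_iter_def by (rule cavity_step_funpow_nonneg) (auto simp: is_config_def)

text \<open>The two inequalities feed each other. The second says x_n(t) \<le> t x_n(s)/s; scaling
  monotonicity followed by antitonicity then gives the first at n+1. The first with antitonicity
  gives the second at n+1, since x_{n+1}(t)/t is the cavity operator at x_n(t).\<close>

lemma cavity_iter_activity_mono:
  assumes "0 < s" and "s \<le> t" and "E i j"
  shows "cavity_iter E mu s n i j \<le> cavity_iter E mu t n i j
       \<and> s * cavity_iter E mu t n i j \<le> t * cavity_iter E mu s n i j"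
  using assms(3)
proof (induction n arbitrary: i j)
  case (Suc n)
  have t: "0 < t" using assms by simp
  let ?x = "cavity_iter E mu s n" and ?y = "cavity_iter E mu t n"
  have "s * GammaN E mu ?x i j = s * GammaN E mu (\<lambda>k l. s * (?x k l / s)) i j"
    using assms by simp
  also have "\<dots> \<le> t * GammaN E mu (\<lambda>k l. t * (?x k l / s)) i j"
    using assms Suc.prems by (intro scaled_GammaN_mono) (auto intro!: divide_nonneg_pos cavity_iter_nonneg)
  also have "\<dots> \<le> t * GammaN E mu ?y i j"
    using assms Suc t
    by (intro mult_left_mono GammaN_antimono) (auto simp: cavity_iter_nonneg field_simps)
  finally have "cavity_iter E mu s (Suc n) i j \<le> cavity_iter E mu t (Suc n) i j"
    by (simp add: cavity_iter_Suc)
  moreover have "GammaN E mu ?y i j \<le> GammaN E mu ?x i j"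
    using assms Suc by (intro GammaN_antimono) (auto intro: cavity_iter_nonneg)
  then have "s * cavity_iter E mu t (Suc n) i j \<le> t * cavity_iter E mu s (Suc n) i j"
    using assms t by (simp add: cavity_iter_Suc mult.left_commute)
  ultimately show ?case ..
qed simp

text \<open>Every application of the antitone operator reverses the comparison that starts from 0
  \<le> x, so equal indices yield lower bounds at even times and upper bounds at odd times.\<close>

lemma cavity_iter_sandwich:
  assumes "is_config E x" and t: "0 < t" and "E i j"
  shows "cavity_iter E mu t (2 * n) i j \<le> (cavity_step t E mu ^^ (2 * n)) x i j
       \<and> (cavity_step t E mu ^^ Suc (2 * n)) x i j \<le> cavity_iter E mu t (Suc (2 * n)) i j"
  using assms(3)
proof (induction n arbitrary: i j)
  case 0
  have "GammaN E mu x i j \<le> GammaN E mu (cavity_iter E mu t 0) i j"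
    using assms 0 by (intro GammaN_antimono) (auto simp: is_config_def)
  then show ?case using assms 0 by (simp add: is_config_def cavity_iter_Suc cavity_step_def)
next
  case (Suc n)
  let ?T = "cavity_step t E mu"
  note nn = cavity_iter_nonneg[OF t] cavity_step_funpow_nonneg[OF assms(1) t]
  have 1: "cavity_iter E mu t (Suc (Suc (2 * n))) i j \<le> (?T ^^ Suc (Suc (2 * n))) x i j"
    if "E i j" for i j
  proof -
    have "GammaN E mu (cavity_iter E mu t (Suc (2 * n))) i j \<le> GammaN E mu ((?T ^^ Suc (2 * n)) x) i j"
      by (rule GammaN_antimono) (use that Suc.IH nn(2)[of _ _ "Suc (2 * n)"] in auto)
    then show ?thesis using t by (simp add: cavity_iter_Suc[of _ _ _ "Suc _"] cavity_step_apply)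
  qed
  have "GammaN E mu ((?T ^^ Suc (Suc (2 * n))) x) i j
      \<le> GammaN E mu (cavity_iter E mu t (Suc (Suc (2 * n)))) i j"
    by (rule GammaN_antimono) (use Suc.prems 1 nn(1) in auto)
  then have "(?T ^^ Suc (Suc (Suc (2 * n)))) x i j \<le> cavity_iter E mu t (Suc (Suc (Suc (2 * n)))) i j"
    using t by (simp add: cavity_iter_Suc[of _ _ _ "Suc (Suc _)"] cavity_step_apply)
  with 1[OF Suc.prems] show ?case by simp
qed

text \<open>Comparing with the orbit started one step later supplies the two missing bounds: from
  above at even and from below at odd indices.\<close>

lemma cavity_iter_sandwich_shift:
  assumes "is_config E x" and t: "0 < t" and e: "E i j"
  shows "(cavity_step t E mu ^^ Suc (Suc (2 * n))) x i j \<le> cavity_iter E mu t (Suc (2 * n)) i j"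
    and "cavity_iter E mu t (2 * n) i j \<le> (cavity_step t E mu ^^ Suc (2 * n)) x i j"
proof -
  have "is_config E (cavity_step t E mu x)"
    using cavity_step_funpow_nonneg[OF assms(1,2), of _ _ 1] by (simp add: is_config_def)
  note * = cavity_iter_sandwich[OF this t e, of n]
  show "(cavity_step t E mu ^^ Suc (Suc (2 * n))) x i j \<le> cavity_iter E mu t (Suc (2 * n)) i j"
    using * by (simp only: funpow_Suc_right comp_def)
  show "cavity_iter E mu t (2 * n) i j \<le> (cavity_step t E mu ^^ Suc (2 * n)) x i j"
    using * by (simp only: funpow_Suc_right comp_def)
qed

lemma is_config_0: "is_config E (\<lambda>_ _. 0)"
  by (simp add: is_config_def)

lemma is_config_cavity_step: "is_config E x \<Longrightarrow> 0 < t \<Longrightarrow> is_config E (cavity_step t E mu x)"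
  using cavity_step_funpow_nonneg[of x t _ _ 1] by (simp add: is_config_def)

text \<open>The orbit of 0 advanced by two steps is again an orbit, so the sandwich compares the
  sequence with its own shift. The last claim is the shifted sandwich for the orbit of 0
  itself.\<close>

lemma cavity_iter_monotonicity:
  assumes t: "0 < t" and e: "E i j"
  shows "cavity_iter E mu t (2 * n) i j \<le> cavity_iter E mu t (2 * Suc n) i j"
    and "cavity_iter E mu t (Suc (2 * Suc n)) i j \<le> cavity_iter E mu t (Suc (2 * n)) i j"
    and "cavity_iter E mu t (2 * n) i j \<le> cavity_iter E mu t (Suc (2 * n)) i j"
proof -
  let ?T = "cavity_step t E mu"
  have c: "is_config E (?T (?T (\<lambda>_ _. 0)))" by (intro is_config_cavity_step is_config_0 t)
  have eq: "(?T ^^ m) (?T (?T (\<lambda>_ _. 0))) = cavity_iter E mu t (Suc (Suc m))" for m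
    by (simp only: cavity_iter_def funpow_Suc_right comp_def)
  show "cavity_iter E mu t (2 * n) i j \<le> cavity_iter E mu t (2 * Suc n) i j"
    "cavity_iter E mu t (Suc (2 * Suc n)) i j \<le> cavity_iter E mu t (Suc (2 * n)) i j"
    using cavity_iter_sandwich[OF c t e, of n] unfolding eq by simp_all
  show "cavity_iter E mu t (2 * n) i j \<le> cavity_iter E mu t (Suc (2 * n)) i j"
    using cavity_iter_sandwich_shift(2)[OF is_config_0 t e, of n] by (simp add: cavity_iter_def)
qed

section \<open>The two limits and their dependence on the activity\<close>

lemma lower_sol_tendsto:
  assumes "0 < t" and "E i j"
  shows "(\<lambda>n. cavity_iter E mu t (2 * n) i j) \<longlonglongrightarrow> lower_sol E mu t i j"
    and "(\<lambda>n. cavity_iter E mu t (Suc (2 * n)) i j) \<longlonglongrightarrow> upper_sol E mu t i j"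
proof -
  note m = cavity_iter_monotonicity[OF assms]
  have dec: "decseq (\<lambda>n. cavity_iter E mu t (Suc (2 * n)) i j)"
    by (rule decseq_SucI) (rule m)
  have "cavity_iter E mu t (2 * n) i j \<le> cavity_iter E mu t (Suc 0) i j" for n
    using order_trans[OF m(3)[of n] decseqD[OF dec, of 0 n]] by simp
  then obtain L where "(\<lambda>n. cavity_iter E mu t (2 * n) i j) \<longlonglongrightarrow> L"
    by (meson incseq_convergent incseq_SucI m(1))
  then show "(\<lambda>n. cavity_iter E mu t (2 * n) i j) \<longlonglongrightarrow> lower_sol E mu t i j"
    unfolding lower_sol_def by (simp add: limI)
  obtain L where "(\<lambda>n. cavity_iter E mu t (Suc (2 * n)) i j) \<longlonglongrightarrow> L"
    by (rule decseq_convergent[OF dec, of 0]) (use assms cavity_iter_nonneg in auto)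
  then show "(\<lambda>n. cavity_iter E mu t (Suc (2 * n)) i j) \<longlonglongrightarrow> upper_sol E mu t i j"
    unfolding upper_sol_def by (simp add: limI)
qed

lemmas upper_sol_tendsto = lower_sol_tendsto(2)

lemma lower_sol_nonneg: "0 < t \<Longrightarrow> E i j \<Longrightarrow> 0 \<le> lower_sol E mu t i j"
  by (rule LIMSEQ_le_const[OF lower_sol_tendsto(1)]) (auto intro: cavity_iter_nonneg)

lemma lower_le_upper: "0 < t \<Longrightarrow> E i j \<Longrightarrow> lower_sol E mu t i j \<le> upper_sol E mu t i j"
  by (rule LIMSEQ_le[OF lower_sol_tendsto]) (auto intro: cavity_iter_monotonicity)

lemma upper_sol_eq:
  assumes "0 < t" and "E i j"
  shows "upper_sol E mu t i j = t * GammaN E mu (lower_sol E mu t) i j"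
proof (rule LIMSEQ_unique[OF upper_sol_tendsto[OF assms]])
  show "(\<lambda>n. cavity_iter E mu t (Suc (2 * n)) i j) \<longlonglongrightarrow> t * GammaN E mu (lower_sol E mu t) i j"
    unfolding cavity_iter_Suc using assms
    by (intro tendsto_mult tendsto_const tendsto_GammaN lower_sol_tendsto lower_sol_nonneg)
qed

lemma lower_sol_eq:
  assumes "0 < t" and "E i j"
  shows "lower_sol E mu t i j = t * GammaN E mu (upper_sol E mu t) i j"
proof (rule LIMSEQ_unique[OF LIMSEQ_Suc[OF lower_sol_tendsto(1)[OF assms]]])
  have "(\<lambda>n. cavity_iter E mu t (Suc (Suc (2 * n))) i j) \<longlonglongrightarrow> t * GammaN E mu (upper_sol E mu t) i j"
    unfolding cavity_iter_Suc[of _ _ _ "Suc _"] using assms order_trans[OF lower_sol_nonneg lower_le_upper]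
    by (intro tendsto_mult tendsto_const tendsto_GammaN upper_sol_tendsto) auto
  then show "(\<lambda>n. cavity_iter E mu t (2 * Suc n) i j) \<longlonglongrightarrow> t * GammaN E mu (upper_sol E mu t) i j"
    by simp
qed

lemma lower_sol_pos: "0 < t \<Longrightarrow> E i j \<Longrightarrow> 0 < lower_sol E mu t i j"
  by (subst lower_sol_eq)
     (auto intro!: mult_pos_pos GammaN_pos order_trans[OF lower_sol_nonneg lower_le_upper])

lemma sol_activity_mono:
  assumes "0 < s" and "s \<le> t" and "E i j"
  shows "lower_sol E mu s i j \<le> lower_sol E mu t i j"
    and "s * upper_sol E mu t i j \<le> t * upper_sol E mu s i j"
proof -
  have t: "0 < t" using assms by simp
  show "lower_sol E mu s i j \<le> lower_sol E mu t i j"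
    by (rule LIMSEQ_le[OF lower_sol_tendsto(1) lower_sol_tendsto(1)])
       (use assms t cavity_iter_activity_mono in auto)
  show "s * upper_sol E mu t i j \<le> t * upper_sol E mu s i j"
    by (rule LIMSEQ_le[OF tendsto_mult[OF tendsto_const upper_sol_tendsto]
          tendsto_mult[OF tendsto_const upper_sol_tendsto]])
       (use assms t cavity_iter_activity_mono in auto)
qed

text \<open>Since \<open>lower_sol\<close> is non-decreasing in the activity and \<open>upper_sol t / t\<close> is
  non-increasing, agreement on a dense set of activities propagates to all of them.\<close>

lemma lower_eq_upper_if_rat:
  assumes rat: "\<And>q::rat. 0 < q \<Longrightarrow> lower_sol E mu (of_rat q) i j = upper_sol E mu (of_rat q) i j"
    and t: "0 < t" and e: "E i j"
  shows "lower_sol E mu t i j = upper_sol E mu t i j"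
proof (rule antisym[OF lower_le_upper[OF t e]])
  have "c * upper_sol E mu t i j \<le> t * lower_sol E mu t i j" if "0 < c" "c < t" for c
  proof -
    obtain q where q: "c < of_rat q" "of_rat q < t" using of_rat_dense[OF \<open>c < t\<close>] by blast
    have q0: "0 < (of_rat q :: real)" using that(1) q(1) by (rule less_trans)
    then have "0 < q" by simp
    have "c * upper_sol E mu t i j \<le> of_rat q * upper_sol E mu t i j"
      using q order_trans[OF lower_sol_nonneg lower_le_upper] t e by (intro mult_right_mono) auto
    also have "\<dots> \<le> t * upper_sol E mu (of_rat q) i j"
      using sol_activity_mono(2)[OF q0 _ e] q by simp
    also have "\<dots> = t * lower_sol E mu (of_rat q) i j" using rat[OF \<open>0 < q\<close>] by simp
    also have "\<dots> \<le> t * lower_sol E mu t i j"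
      using sol_activity_mono(1)[OF q0 _ e] q t by simp
    finally show ?thesis .
  qed
  then have "\<forall>\<^sub>F c in at_left t. c * upper_sol E mu t i j \<le> t * lower_sol E mu t i j"
    using eventually_at_left_real[OF t] by (auto elim: eventually_mono)
  moreover have "((\<lambda>c. c * upper_sol E mu t i j) \<longlongrightarrow> t * upper_sol E mu t i j) (at_left t)"
    by (intro tendsto_intros)
  ultimately have "t * upper_sol E mu t i j \<le> t * lower_sol E mu t i j"
    by (intro tendsto_upperbound) auto
  then show "upper_sol E mu t i j \<le> lower_sol E mu t i j" using t by simp
qed

section \<open>The globally attractive solution\<close>

lemma GAS_unique:
  assumes "GAS E mu t x" and "GAS E mu t y" and "E i j"
  shows "x i j = y i j"
proof (rule LIMSEQ_unique)
  show "(\<lambda>n. (cavity_step t E mu ^^ n) (\<lambda>_ _. 0) i j) \<longlonglongrightarrow> x i j"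
    "(\<lambda>n. (cavity_step t E mu ^^ n) (\<lambda>_ _. 0) i j) \<longlonglongrightarrow> y i j"
    using assms is_config_0 unfolding GAS_def by blast+
qed

lemma GAS_lower_sol:
  assumes t: "0 < t" and eq: "\<And>i j. E i j \<Longrightarrow> lower_sol E mu t i j = upper_sol E mu t i j"
  shows "GAS E mu t (lower_sol E mu t)"
  unfolding GAS_def
proof (intro conjI allI impI)
  show "is_config E (lower_sol E mu t)" using lower_sol_nonneg[OF t] by (simp add: is_config_def)
  show "lower_sol E mu t i j = t * GammaN E mu (lower_sol E mu t) i j" if "E i j" for i j
    using upper_sol_eq[OF t that] eq[OF that] by simp
  fix x i j assume x: "is_config E x" and e: "E i j"
  note lims = lower_sol_tendsto(1)[OF t e] upper_sol_tendsto[OF t e, folded eq[OF e]]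
  note sand = cavity_iter_sandwich[OF x t e] cavity_iter_sandwich_shift[OF x t e]
  show "(\<lambda>n. (cavity_step t E mu ^^ n) x i j) \<longlonglongrightarrow> lower_sol E mu t i j"
  proof (rule LIMSEQ_even_odd)
    show "(\<lambda>n. (cavity_step t E mu ^^ Suc (2 * n)) x i j) \<longlonglongrightarrow> lower_sol E mu t i j"
      by (rule tendsto_sandwich[OF _ _ lims]) (use sand in auto)
    \<comment> \<open>The upper bound at time 2n+2 is the iterate of 0 at time 2n+1, hence the shift
      in the even subsequence.\<close>
    have "(\<lambda>n. (cavity_step t E mu ^^ (2 * Suc n)) x i j) \<longlonglongrightarrow> lower_sol E mu t i j"
    proof (rule tendsto_sandwich[OF _ _ LIMSEQ_Suc[OF lims(1)] lims(2)])
      show "\<forall>\<^sub>F n in sequentially.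
          cavity_iter E mu t (2 * Suc n) i j \<le> (cavity_step t E mu ^^ (2 * Suc n)) x i j"
        using sand(1)[of "Suc _"] by (intro always_eventually) blast
      show "\<forall>\<^sub>F n in sequentially.
          (cavity_step t E mu ^^ (2 * Suc n)) x i j \<le> cavity_iter E mu t (Suc (2 * n)) i j"
        using sand(2) by simp
    qed
    then show "(\<lambda>n. (cavity_step t E mu ^^ (2 * n)) x i j) \<longlonglongrightarrow> lower_sol E mu t i j"
      by (rule LIMSEQ_imp_Suc)
  qed
qed

lemma has_unique_GAS_if:
  "0 < t \<Longrightarrow> (\<And>i j. E i j \<Longrightarrow> lower_sol E mu t i j = upper_sol E mu t i j) \<Longrightarrow> has_unique_GAS E mu t"
  unfolding has_unique_GAS_def using GAS_lower_sol GAS_unique by blast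

text \<open>Whichever solution the choice operator picks attracts the orbit of 0, so the even and
  the odd subsequence both converge to it. This replaces the choice by explicit limits.\<close>

lemma xsol_eq:
  assumes "has_unique_GAS E mu t" and t: "0 < t" and e: "E i j"
  shows "xsol E mu t i j = lower_sol E mu t i j" and "xsol E mu t i j = upper_sol E mu t i j"
proof -
  define x where "x = (SOME x. GAS E mu t x)"
  have "\<exists>x. GAS E mu t x" using assms by (simp add: has_unique_GAS_def)
  then have "GAS E mu t x" unfolding x_def by (rule someI_ex)
  then have "(\<lambda>n. cavity_iter E mu t n i j) \<longlonglongrightarrow> x i j"
    unfolding cavity_iter_def GAS_def using is_config_0 e by blast
  moreover have "strict_mono (\<lambda>n::nat. 2 * n)" "strict_mono (\<lambda>n::nat. Suc (2 * n))"
    by (auto simp: strict_mono_def)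
  ultimately have "(\<lambda>n. cavity_iter E mu t (2 * n) i j) \<longlonglongrightarrow> x i j"
    and "(\<lambda>n. cavity_iter E mu t (Suc (2 * n)) i j) \<longlonglongrightarrow> x i j"
    using LIMSEQ_subseq_LIMSEQ[unfolded comp_def] by blast+
  then have "x i j = lower_sol E mu t i j" "x i j = upper_sol E mu t i j"
    using lower_sol_tendsto[OF t e] LIMSEQ_unique by blast+
  then show "xsol E mu t i j = lower_sol E mu t i j" "xsol E mu t i j = upper_sol E mu t i j"
    using e by (simp_all add: xsol_def x_def)
qed

subsection \<open>Infinite activity\<close>

lemma Gamma_bar_tendsto:
  assumes e: "E i j" and z: "\<And>k. E k i \<Longrightarrow> 0 \<le> z k i"
  shows "((\<lambda>t. ereal (t * GammaN E mu (\<lambda>k l. t * z k l) i j)) \<longlongrightarrow> Gamma_bar E mu z i j) at_top"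
    and "0 < s \<Longrightarrow> ereal (s * GammaN E mu (\<lambda>k l. s * z k l) i j) \<le> Gamma_bar E mu z i j"
proof -
  let ?f = "\<lambda>t. ereal (t * GammaN E mu (\<lambda>k l. t * z k l) i j)"
  have lim: "(?f \<longlongrightarrow> (SUP t\<in>{0<..}. ?f t)) at_top"
    by (rule mono_tendsto_SUP_at_top) (use scaled_GammaN_mono[of i j z, OF e z] in auto)
  then have eq: "Gamma_bar E mu z i j = (SUP t\<in>{0<..}. ?f t)"
    unfolding Gamma_bar_def by (intro tendsto_Lim) auto
  show "(?f \<longlongrightarrow> Gamma_bar E mu z i j) at_top" using lim eq by simp
  show "?f s \<le> Gamma_bar E mu z i j" if "0 < s" unfolding eq using that by (intro SUP_upper) auto
qed

lemma Gamma_ext_eq: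
  "Gamma_ext E mu y i j = lim (\<lambda>n. cavity_ratio (nbrs E i) (mu i) j (truncate (\<lambda>k. y k i) n))"
  by (simp add: Gamma_ext_def GammaN_def truncate_def)

lemma Gamma_ext_nonneg:
  assumes e: "E i j" and y: "\<And>k. E k i \<Longrightarrow> 0 \<le> y k i"
  shows "0 \<le> Gamma_ext E mu y i j"
  unfolding Gamma_ext_eq
  by (rule cavity_measure.cavity_ratio_truncation(1)[OF cavity_measure_edge[OF e]])
     (use assms in \<open>auto simp: nbrs_def E_sym\<close>)

lemma Gamma_ext_le:
  assumes e: "E i j" and "\<And>k. E k i \<Longrightarrow> 0 \<le> w k i" and "\<And>k. E k i \<Longrightarrow> ereal (w k i) \<le> y k i"
  shows "Gamma_ext E mu y i j \<le> GammaN E mu w i j"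
proof -
  have "0 \<le> y k i" if "E k i" for k
    using assms(2,3)[OF that] by (metis ereal_less_eq(5) order_trans)
  then show ?thesis
    unfolding Gamma_ext_eq GammaN_def using assms
    by (intro cavity_measure.cavity_ratio_truncation(2)[OF cavity_measure_edge[OF e]])
       (auto simp: nbrs_def E_sym)
qed

lemma tendsto_Gamma_ext:
  assumes e: "E i j" and y: "\<And>k. E k i \<Longrightarrow> 0 \<le> y k i"
    and X: "\<And>k. E k i \<Longrightarrow> \<forall>\<^sub>F x in F. 0 \<le> X x k i \<and> ereal (X x k i) \<le> y k i"
    and lim: "\<And>k. E k i \<Longrightarrow> ((\<lambda>x. ereal (X x k i)) \<longlongrightarrow> y k i) F"
  shows "((\<lambda>x. GammaN E mu (X x) i j) \<longlongrightarrow> Gamma_ext E mu y i j) F"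
proof -
  interpret cavity_measure "nbrs E i" "mu i" by (rule cavity_measure_edge[OF e])
  have "\<forall>\<^sub>F x in F. \<forall>k\<in>nbrs E i - {j}. 0 \<le> X x k i \<and> ereal (X x k i) \<le> y k i"
    by (rule eventually_ball_finite) (use finite_S X in \<open>auto dest: nbrs_sym\<close>)
  then show ?thesis
    unfolding Gamma_ext_eq GammaN_def using e y lim
    by (intro cavity_ratio_truncation(3)) (auto simp: nbrs_def E_sym)
qed

context
  assumes regular: "\<And>t. 0 < t \<Longrightarrow> has_unique_GAS E mu t"
begin

lemma xsol_nonneg: "0 < t \<Longrightarrow> E i j \<Longrightarrow> 0 \<le> xsol E mu t i j"
  using xsol_eq(1)[OF regular] lower_sol_nonneg by simp

lemma xsol_fixpoint: "0 < t \<Longrightarrow> E i j \<Longrightarrow> xsol E mu t i j = t * GammaN E mu (xsol E mu t) i j"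
proof -
  assume t: "0 < t" and e: "E i j"
  have "xsol E mu t i j = t * GammaN E mu (lower_sol E mu t) i j"
    using xsol_eq(2)[OF regular[OF t] t e] upper_sol_eq[OF t e] by simp
  \<comment> \<open>The two configurations agree on the edges into \<open>i\<close>; antitonicity
    used in both directions serves as a congruence rule.\<close>
  also have "GammaN E mu (lower_sol E mu t) i j = GammaN E mu (xsol E mu t) i j"
    by (rule antisym; rule GammaN_antimono)
       (use e t xsol_eq(1)[OF regular[OF t] t] lower_sol_nonneg[OF t] in auto)
  finally show ?thesis .
qed

lemma xsol_mono: "0 < s \<Longrightarrow> s \<le> t \<Longrightarrow> E i j \<Longrightarrow> xsol E mu s i j \<le> xsol E mu t i j"
  using xsol_eq(1)[OF regular] sol_activity_mono(1) by simp

lemma xbar_tendsto: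
  assumes e: "E i j"
  shows "((\<lambda>t. ereal (xsol E mu t i j)) \<longlongrightarrow> xbar E mu i j) at_top"
    and "0 < t \<Longrightarrow> ereal (xsol E mu t i j) \<le> xbar E mu i j"
proof -
  let ?f = "\<lambda>t. ereal (xsol E mu t i j)"
  have lim: "(?f \<longlongrightarrow> (SUP t\<in>{0<..}. ?f t)) at_top"
    by (rule mono_tendsto_SUP_at_top) (use xsol_mono[OF _ _ e] in auto)
  then have eq: "xbar E mu i j = (SUP t\<in>{0<..}. ?f t)"
    unfolding xbar_def by (intro tendsto_Lim) auto
  show "(?f \<longlongrightarrow> xbar E mu i j) at_top" using lim eq by simp
  show "?f t \<le> xbar E mu i j" if "0 < t" unfolding eq using that by (intro SUP_upper) auto
qed

lemma xbar_pos:
  assumes e: "E i j"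
  shows "0 < xbar E mu i j"
proof -
  have "0 < ereal (xsol E mu 1 i j)"
    using xsol_eq(1)[OF regular _ e, of 1] lower_sol_pos[OF _ e, of 1] by simp
  then show ?thesis using xbar_tendsto(2)[OF e, of 1] by (rule less_le_trans) simp
qed

text \<open>Put z = \<open>?z\<close>, the limit of the decreasing \<Gamma>(x(t)). Since
  \<Gamma>(x(t)) \<ge> z, the identity \<open>fix2\<close> gives x(t) \<le> t \<Gamma>(t z), hence
  one inequality. For the other, t \<ge> s gives s \<Gamma>(s \<Gamma>(x(t))) \<le> x(t); sending t
  and only then s to infinity separates the inner limit from the outer one.\<close>

lemma xbar_inf_cavity_eq: "inf_cavity_eq E mu (xbar E mu)"
  unfolding inf_cavity_eq_def
proof (intro allI impI antisym)
  fix i j assume e: "E i j"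
  let ?z = "Gamma_ext E mu (xbar E mu)"
  have nn: "0 \<le> ?z k l" if "E k l" for k l
    using that by (intro Gamma_ext_nonneg less_imp_le[OF xbar_pos])
  have z_le: "?z k l \<le> GammaN E mu (xsol E mu t) k l" if "E k l" "0 < t" for k l t
    using that by (intro Gamma_ext_le xsol_nonneg xbar_tendsto(2))
  have z_lim: "((\<lambda>t. GammaN E mu (xsol E mu t) k l) \<longlongrightarrow> ?z k l) at_top" if "E k l" for k l
  proof (rule tendsto_Gamma_ext[OF that])
    fix m assume m: "E m k"
    show "0 \<le> xbar E mu m k" by (rule less_imp_le[OF xbar_pos[OF m]])
    show "((\<lambda>t. ereal (xsol E mu t m k)) \<longlongrightarrow> xbar E mu m k) at_top" by (rule xbar_tendsto[OF m])
    show "\<forall>\<^sub>F t in at_top. 0 \<le> xsol E mu t m k \<and> ereal (xsol E mu t m k) \<le> xbar E mu m k"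
      using eventually_gt_at_top[of 0] by eventually_elim (simp add: m xsol_nonneg xbar_tendsto(2))
  qed
  have fix2: "xsol E mu t i j = t * GammaN E mu (\<lambda>k l. t * GammaN E mu (xsol E mu t) k l) i j"
    if "0 < t" for t
  proof -
    have "GammaN E mu (xsol E mu t) i j = GammaN E mu (\<lambda>k l. t * GammaN E mu (xsol E mu t) k l) i j"
      by (rule antisym; rule GammaN_antimono)
         (use e that xsol_fixpoint[OF that] xsol_nonneg[OF that] in auto)
    then show ?thesis using xsol_fixpoint[OF that e] by simp
  qed
  show "xbar E mu i j \<le> Gamma_bar E mu ?z i j"
  proof (rule tendsto_upperbound[OF xbar_tendsto(1)[OF e]])
    show "\<forall>\<^sub>F t in at_top. ereal (xsol E mu t i j) \<le> Gamma_bar E mu ?z i j"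
      using eventually_gt_at_top[of 0]
    proof eventually_elim
      case (elim t)
      have "xsol E mu t i j \<le> t * GammaN E mu (\<lambda>k l. t * ?z k l) i j"
        unfolding fix2[OF elim] using e elim nn z_le
        by (intro mult_left_mono GammaN_antimono) auto
      then have "ereal (xsol E mu t i j) \<le> ereal (t * GammaN E mu (\<lambda>k l. t * ?z k l) i j)" by simp
      also have "\<dots> \<le> Gamma_bar E mu ?z i j" by (rule Gamma_bar_tendsto(2)[OF e nn elim])
      finally show ?case .
    qed
  qed simp
  show "Gamma_bar E mu ?z i j \<le> xbar E mu i j"
  proof (rule tendsto_upperbound)
    show "((\<lambda>s. ereal (s * GammaN E mu (\<lambda>k l. s * ?z k l) i j)) \<longlongrightarrow> Gamma_bar E mu ?z i j) at_top"
      by (rule Gamma_bar_tendsto(1)[OF e nn])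
    show "\<forall>\<^sub>F s in at_top. ereal (s * GammaN E mu (\<lambda>k l. s * ?z k l) i j) \<le> xbar E mu i j"
      using eventually_gt_at_top[of 0]
    proof eventually_elim
      case (elim s)
      \<comment> \<open>With \<open>s\<close> frozen the inner arguments converge to the finite
        values \<open>s * ?z k l\<close>, so continuity at finite weights is enough.\<close>
      have lim: "((\<lambda>t. ereal (s * GammaN E mu (\<lambda>k l. s * GammaN E mu (xsol E mu t) k l) i j))
          \<longlongrightarrow> ereal (s * GammaN E mu (\<lambda>k l. s * ?z k l) i j)) at_top"
        using e elim nn by (intro tendsto_ereal tendsto_mult tendsto_const tendsto_GammaN z_lim) auto
      show ?case
      proof (rule tendsto_upperbound[OF lim])
        show "\<forall>\<^sub>F t in at_top. ereal (s * GammaN E mu (\<lambda>k l. s * GammaN E mu (xsol E mu t) k l) i j)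
            \<le> xbar E mu i j"
          using eventually_ge_at_top[of s]
        proof eventually_elim
          case (elim t)
          with \<open>0 < s\<close> have t: "0 < t" by simp
          have "s * GammaN E mu (\<lambda>k l. s * GammaN E mu (xsol E mu t) k l) i j \<le> xsol E mu t i j"
            unfolding fix2[OF t] using e elim \<open>0 < s\<close> t
            by (intro scaled_GammaN_mono less_imp_le[OF GammaN_pos]) (auto intro: xsol_nonneg)
          then show ?case
            using xbar_tendsto(2)[OF e t] by (meson ereal_less_eq(3) order_trans)
        qed
      qed simp
    qed
  qed simp
qed

text \<open>If an even iterate is below y, the next odd one is above t \<Gamma>(y), and the even one
  after that is below t \<Gamma>(t \<Gamma>(y)). This is at most its supremum over t, which equals
  y. The bound holds for all n and t at once.\<close>

lemma xbar_least:
  assumes pos: "\<And>i j. E i j \<Longrightarrow> 0 < y i j" and y: "inf_cavity_eq E mu y" and e: "E i j"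
  shows "xbar E mu i j \<le> y i j"
proof (rule tendsto_upperbound[OF xbar_tendsto(1)[OF e]])
  let ?z = "Gamma_ext E mu y"
  have nn: "0 \<le> ?z k l" if "E k l" for k l
    using that by (intro Gamma_ext_nonneg less_imp_le[OF pos])
  have iter_le: "ereal (cavity_iter E mu t (2 * n) i j) \<le> y i j" if t: "0 < t" and "E i j" for t n i j
    using that(2)
  proof (induction n arbitrary: i j)
    case 0 then show ?case using pos by (simp add: less_imp_le zero_ereal_def[symmetric])
  next
    case (Suc n)
    have "t * ?z k l \<le> cavity_iter E mu t (Suc (2 * n)) k l" if "E k l" for k l
      unfolding cavity_iter_Suc using t that Suc.IH
      by (intro mult_left_mono Gamma_ext_le) (auto intro: cavity_iter_nonneg)
    then have "cavity_iter E mu t (Suc (Suc (2 * n))) i j \<le> t * GammaN E mu (\<lambda>k l. t * ?z k l) i j"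
      unfolding cavity_iter_Suc[of _ _ _ "Suc _"] using t Suc.prems nn
      by (intro mult_left_mono GammaN_antimono) auto
    then have "ereal (cavity_iter E mu t (2 * Suc n) i j) \<le> ereal (t * GammaN E mu (\<lambda>k l. t * ?z k l) i j)"
      by simp
    also have "\<dots> \<le> Gamma_bar E mu ?z i j" by (rule Gamma_bar_tendsto(2)[OF Suc.prems nn t])
    also have "\<dots> = y i j" using y Suc.prems by (simp add: inf_cavity_eq_def)
    finally show ?case .
  qed
  show "\<forall>\<^sub>F t in at_top. ereal (xsol E mu t i j) \<le> y i j"
    using eventually_gt_at_top[of 0]
  proof eventually_elim
    case (elim t)
    have "(\<lambda>n. ereal (cavity_iter E mu t (2 * n) i j)) \<longlonglongrightarrow> ereal (xsol E mu t i j)"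
      unfolding xsol_eq(1)[OF regular[OF elim] elim e] by (intro tendsto_ereal lower_sol_tendsto elim e)
    then show ?case by (rule LIMSEQ_le_const2) (use iter_le[OF elim e] in auto)
  qed
qed simp

end

end

section \<open>Unimodular networks\<close>

text \<open>Outside the networks, \<open>net_E\<close> may be asymmetric or leave the vertex set, which
  isomorphisms do not see; cutting it down makes everything built from it isomorphism invariant.\<close>

definition net_edge :: "net \<Rightarrow> nat \<Rightarrow> nat \<Rightarrow> bool" where
  "net_edge G i j \<longleftrightarrow> net_E G i j \<and> net_E G j i \<and> i \<in> net_V G \<and> j \<in> net_V G"

lemma net_edge_eq: "network (net_V G) (net_E G) \<Longrightarrow> net_edge G = net_E G"
  by (intro ext) (auto simp: net_edge_def network_def)

lemma nbrs_net_edge_subset: "nbrs (net_edge G) i \<subseteq> net_V G" "nbrs (net_edge G) i \<subseteq> nbrs (net_E G) i"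
  by (auto simp: nbrs_def net_edge_def)

section \<open>Isomorphism invariance of the extremal solutions\<close>

lemma net_iso_edge:
  assumes "net_iso G G' p" and "u \<in> net_V G" and "v \<in> net_V G"
  shows "net_edge G' (p u) (p v) = net_edge G u v"
  using assms by (auto simp: net_iso_def net_edge_def bij_betw_def)

lemma net_iso_nbrs:
  assumes iso: "net_iso G G' p" and u: "u \<in> net_V G"
  shows "nbrs (net_edge G') (p u) = p ` nbrs (net_edge G) u"
proof (intro set_eqI iffI)
  fix x assume x: "x \<in> nbrs (net_edge G') (p u)"
  then have "x \<in> net_V G'" using nbrs_net_edge_subset(1) by blast
  also have "net_V G' = p ` net_V G" using iso by (simp add: net_iso_def bij_betw_def)
  finally obtain v where v: "v \<in> net_V G" "x = p v" by blast
  then show "x \<in> p ` nbrs (net_edge G) u" using x net_iso_edge[OF iso u] by (auto simp: nbrs_def)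
next
  fix x assume "x \<in> p ` nbrs (net_edge G) u"
  then obtain v where v: "v \<in> nbrs (net_edge G) u" "x = p v" by blast
  then have "v \<in> net_V G" using nbrs_net_edge_subset(1) by blast
  then show "x \<in> nbrs (net_edge G') (p u)" using v net_iso_edge[OF iso u] by (auto simp: nbrs_def)
qed

lemma Zpart_reindex:
  assumes "inj_on p T" and "\<And>F. F \<subseteq> T \<Longrightarrow> h' (p ` F) = h F" and "\<And>e. e \<in> T \<Longrightarrow> w' (p e) = w e"
  shows "Zpart (p ` T) h' w' = Zpart T h w"
proof -
  have "Pow (p ` T) = image p ` Pow T" by (rule image_Pow_surj[symmetric]) simp
  moreover have "inj_on (image p) (Pow T)" using assms(1) by (rule inj_on_image_Pow)
  ultimately have "Zpart (p ` T) h' w' = (\<Sum>F\<in>Pow T. h' (p ` F) * prod w' (p ` F))"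
    unfolding Zpart_def by (simp add: sum.reindex)
  also have "\<dots> = Zpart T h w"
    unfolding Zpart_def
  proof (rule sum.cong)
    fix F assume "F \<in> Pow T"
    then have F: "F \<subseteq> T" by simp
    then have "prod w' (p ` F) = prod w F"
      using inj_on_subset[OF assms(1) F] assms(3) by (auto simp: prod.reindex intro!: prod.cong)
    then show "h' (p ` F) * prod w' (p ` F) = h F * prod w F" using assms(2)[OF F] by simp
  qed simp
  finally show ?thesis .
qed

lemma net_iso_GammaN:
  assumes iso: "net_iso G G' p" and e: "net_edge G i j"
    and x: "\<And>k. net_edge G k i \<Longrightarrow> x' (p k) (p i) = x k i"
  shows "GammaN (net_edge G') (net_mu G') x' (p i) (p j) = GammaN (net_edge G) (net_mu G) x i j"
proof -
  let ?N = "nbrs (net_edge G) i"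
  have i: "i \<in> net_V G" and j: "j \<in> ?N" using e by (auto simp: net_edge_def nbrs_def)
  have "inj_on p (net_V G)" using iso by (simp add: net_iso_def bij_betw_def)
  then have inj: "inj_on p ?N" by (rule inj_on_subset) (rule nbrs_net_edge_subset)
  have mu: "net_mu G' (p i) (p ` F) = net_mu G i F" if "F \<subseteq> ?N" for F
    using iso i that nbrs_net_edge_subset(2)[of G i] unfolding net_iso_def by blast
  have eq: "nbrs (net_edge G') (p i) - {p j} = p ` (?N - {j})"
    using inj j by (simp add: net_iso_nbrs[OF iso i] inj_on_image_set_diff[OF inj])
  have inj': "inj_on p (?N - {j})" using inj by (rule inj_on_subset) auto
  have w: "x' (p k) (p i) = x k i" if "k \<in> ?N - {j}" for k
    using that by (intro x) (auto simp: nbrs_def net_edge_def)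
  have "Zpart (p ` (?N - {j})) (net_mu G' (p i)) (\<lambda>k. x' k (p i))
      = Zpart (?N - {j}) (net_mu G i) (\<lambda>k. x k i)"
    by (rule Zpart_reindex[OF inj']) (use mu w in auto)
  moreover have "Zpart (p ` (?N - {j})) (\<lambda>F. net_mu G' (p i) (insert (p j) F)) (\<lambda>k. x' k (p i))
      = Zpart (?N - {j}) (\<lambda>F. net_mu G i (insert j F)) (\<lambda>k. x k i)"
  proof (rule Zpart_reindex[OF inj'])
    fix F assume "F \<subseteq> ?N - {j}"
    with j have "insert j F \<subseteq> ?N" by auto
    from mu[OF this] show "net_mu G' (p i) (insert (p j) (p ` F)) = net_mu G i (insert j F)" by simp
  qed (use w in auto)
  ultimately show ?thesis by (simp add: GammaN_def cavity_ratio_eq_Zpart eq)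
qed

lemma net_iso_cavity_iter:
  assumes iso: "net_iso G G' p" and "net_edge G i j"
  shows "cavity_iter (net_edge G') (net_mu G') t n (p i) (p j) = cavity_iter (net_edge G) (net_mu G) t n i j"
  using assms(2)
proof (induction n arbitrary: i j)
  case (Suc n)
  then show ?case unfolding cavity_iter_Suc by (simp add: net_iso_GammaN[OF iso])
qed simp

abbreviation net_lower :: "real \<Rightarrow> net \<Rightarrow> nat \<Rightarrow> nat \<Rightarrow> real" where
  "net_lower t G \<equiv> lower_sol (net_edge G) (net_mu G) t"

abbreviation net_upper :: "real \<Rightarrow> net \<Rightarrow> nat \<Rightarrow> nat \<Rightarrow> real" where
  "net_upper t G \<equiv> upper_sol (net_edge G) (net_mu G) t"

lemma net_iso_sol:
  assumes "net_iso G G' p" and "net_edge G i j"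
  shows "net_lower t G' (p i) (p j) = net_lower t G i j"
    and "net_upper t G' (p i) (p j) = net_upper t G i j"
  using assms by (simp_all add: lower_sol_def upper_sol_def net_iso_cavity_iter)

section \<open>Measurability on the space of labelled networks\<close>

lemma measurable_net_V [measurable]: "Measurable.pred M_net (\<lambda>G. v \<in> net_V G)"
proof -
  have "(\<lambda>G::net. fst G v) \<in> M_net \<rightarrow>\<^sub>M count_space UNIV"
    unfolding M_net_def
    by (rule measurable_compose[OF measurable_fst measurable_component_singleton]) simp
  then show ?thesis by (simp add: net_V_def)
qed

lemma measurable_net_E [measurable]: "Measurable.pred M_net (\<lambda>G. net_E G i j)"
proof -
  have "(\<lambda>G::net. fst (snd G) i) \<in> M_net \<rightarrow>\<^sub>M PiM UNIV (\<lambda>_. count_space UNIV)"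
    unfolding M_net_def
    by (rule measurable_compose[OF measurable_compose[OF measurable_snd measurable_fst]
          measurable_component_singleton]) simp
  from measurable_compose[OF this measurable_component_singleton[of j]]
  show ?thesis by (simp add: net_E_def)
qed

lemma measurable_net_mu [measurable]: "(\<lambda>G. net_mu G i F) \<in> borel_measurable M_net"
proof -
  have "(\<lambda>G::net. snd (snd G) i) \<in> M_net \<rightarrow>\<^sub>M PiM UNIV (\<lambda>_. borel)"
    unfolding M_net_def
    by (rule measurable_compose[OF measurable_compose[OF measurable_snd measurable_snd]
          measurable_component_singleton]) simp
  from measurable_compose[OF this measurable_component_singleton[of F]]
  show ?thesis by (simp add: net_mu_def)
qed

lemma measurable_net_edge [measurable]: "Measurable.pred M_net (\<lambda>G. net_edge G i j)"
  unfolding net_edge_def by measurable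

text \<open>The ground set varies with \<open>x\<close>, but there are only countably many finite
  sets of naturals, and for each fixed one the partition function is a finite sum of measurable
  terms.\<close>

lemma borel_measurable_Zpart:
  fixes T :: "'a \<Rightarrow> nat set"
  assumes T [measurable]: "\<And>j. Measurable.pred M (\<lambda>x. j \<in> T x)"
    and [measurable]: "\<And>F. (\<lambda>x. h x F) \<in> borel_measurable M" "\<And>k. (\<lambda>x. w x k) \<in> borel_measurable M"
  shows "(\<lambda>x. Zpart (T x) (h x) (w x)) \<in> borel_measurable M"
proof -
  define T' where "T' x = (if finite (T x) then T x else {})" for x
  have fin [measurable]: "Measurable.pred M (\<lambda>x. finite (T x))"
    unfolding finite_nat_set_iff_bounded Ball_def by measurable
  have "T' \<in> M \<rightarrow>\<^sub>M count_space {S. finite S}"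
  proof (subst measurable_count_space_eq_countable)
    show "countable {S :: nat set. finite S}" by (rule countable_Collect_finite)
    have "T' -` {S} \<inter> space M \<in> sets M" for S
    proof -
      have "T' -` {S} \<inter> space M = {x \<in> space M. \<forall>j. (j \<in> T x \<and> finite (T x)) = (j \<in> S)}"
        by (auto simp: T'_def split: if_splits)
      also have "\<dots> \<in> sets M" by measurable
      finally show ?thesis .
    qed
    then show "T' \<in> space M \<rightarrow> {S. finite S} \<and> (\<forall>S\<in>{S. finite S}. T' -` {S} \<inter> space M \<in> sets M)"
      by (auto simp: T'_def)
  qed
  then have "(\<lambda>x. Zpart (T' x) (h x) (w x)) \<in> borel_measurable M"
  proof (rule measurable_compose_countable'[rotated])
    show "countable {S :: nat set. finite S}" by (rule countable_Collect_finite)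
    show "(\<lambda>x. Zpart S (h x) (w x)) \<in> borel_measurable M" for S
      unfolding Zpart_def by measurable
  qed
  then have "(\<lambda>x. if finite (T x) then Zpart (T' x) (h x) (w x) else 0) \<in> borel_measurable M"
    by measurable
  \<comment> \<open>An infinite ground set has an infinite power set, over which the sum is 0 by
    convention; this accounts for the default value.\<close>
  also have "(\<lambda>x. if finite (T x) then Zpart (T' x) (h x) (w x) else 0) = (\<lambda>x. Zpart (T x) (h x) (w x))"
    by (auto simp: T'_def Zpart_def)
  finally show ?thesis .
qed

lemma measurable_cavity_iter [measurable]:
  "(\<lambda>G. cavity_iter (net_edge G) (net_mu G) t n i j) \<in> borel_measurable M_net"
proof (induction n arbitrary: i j)
  case (Suc n)
  note [measurable] = Suc
  have [measurable]: "Measurable.pred M_net (\<lambda>G. k \<in> nbrs (net_edge G) i - {j})" for k i j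
    unfolding nbrs_def by (cases "k = j") (simp_all, measurable)
  show ?case
    unfolding cavity_iter_Suc GammaN_def cavity_ratio_eq_Zpart
    by (intro borel_measurable_times borel_measurable_divide borel_measurable_Zpart) measurable
qed simp

lemma measurable_net_sol [measurable]:
  "(\<lambda>G. net_lower t G i j) \<in> borel_measurable M_net"
  "(\<lambda>G. net_upper t G i j) \<in> borel_measurable M_net"
  unfolding lower_sol_def upper_sol_def by measurable

lemma measurable_net_Umean:
  assumes [measurable]: "\<And>k. (\<lambda>G. w G k) \<in> borel_measurable M_net"
  shows "(\<lambda>G. Umean (nbrs (net_edge G) i) (net_mu G i) (w G)) \<in> borel_measurable M_net"
proof -
  have [measurable]: "Measurable.pred M_net (\<lambda>G. k \<in> nbrs (net_edge G) i)" for k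
    by (simp add: nbrs_def)
  show ?thesis unfolding Umean_eq_Zpart
    by (intro borel_measurable_divide borel_measurable_Zpart) measurable
qed

text \<open>The two marks range over a countable set, so joint measurability can be checked with the
  marks fixed.\<close>

lemma measurable_net_pair:
  assumes "\<And>a b. (\<lambda>G. h G a b) \<in> borel_measurable M_net"
  shows "(\<lambda>(G, a :: nat, b :: nat). h G a b)
     \<in> borel_measurable (M_net \<Otimes>\<^sub>M (count_space UNIV \<Otimes>\<^sub>M count_space UNIV))"
proof -
  let ?M = "M_net \<Otimes>\<^sub>M (count_space (UNIV :: nat set) \<Otimes>\<^sub>M count_space (UNIV :: nat set))"
  have m: "(\<lambda>z. h (fst z) a b) \<in> borel_measurable ?M" for a b
    by (rule measurable_compose[OF measurable_fst assms])
  have "(\<lambda>z. h (fst z) (fst (snd z)) b) \<in> borel_measurable ?M" for b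
    by (rule measurable_compose_countable[where f = "\<lambda>a z. h (fst z) a b", OF m]) measurable
  then have "(\<lambda>z. h (fst z) (fst (snd z)) (snd (snd z))) \<in> borel_measurable ?M"
    by (rule measurable_compose_countable[where f = "\<lambda>b z. h (fst z) (fst (snd z)) b"]) measurable
  then show ?thesis by (simp add: case_prod_beta')
qed

section \<open>Occupation of an edge seen from its two ends\<close>

context cavity_network
begin

text \<open>At the activity \<open>t\<close> the two extremal solutions satisfy \<open>upper = t * Gamma lower\<close> and
  \<open>lower = t * Gamma upper\<close>, so the occupation probability of an edge under one family of
  weights is symmetric to the one under the other family seen from the opposite endpoint.\<close>

lemma Umean_sol_eq:
  assumes t: "0 < t" and i: "i \<in> V"
  shows "Umean (nbrs E i) (mu i) (\<lambda>k. lower_sol E mu t k i)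
      = (\<Sum>k\<in>nbrs E i. lower_sol E mu t k i * upper_sol E mu t i k
          / (t + lower_sol E mu t k i * upper_sol E mu t i k))" (is ?lo)
    and "Umean (nbrs E i) (mu i) (\<lambda>k. upper_sol E mu t k i)
      = (\<Sum>k\<in>nbrs E i. lower_sol E mu t i k * upper_sol E mu t k i
          / (t + lower_sol E mu t i k * upper_sol E mu t k i))" (is ?up)
proof -
  interpret cavity_measure "nbrs E i" "mu i" by (rule cavity_measure_at[OF i])
  have lo: "0 \<le> lower_sol E mu t k i" and up: "0 \<le> upper_sol E mu t k i" if "k \<in> nbrs E i" for k
    using nbrs_sym[OF that] lower_sol_nonneg[OF t] lower_le_upper[OF t] order_trans by blast+
  have ratio: "w * g / (1 + w * g) = (w * (t * g)) / (t + w * (t * g))" for w g :: real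
  proof -
    have "(w * (t * g)) / (t + w * (t * g)) = (t * (w * g)) / (t * (1 + w * g))"
      by (simp add: algebra_simps)
    then show ?thesis using t by simp
  qed
  have e: "E i k" if "k \<in> nbrs E i" for k using that by (simp add: nbrs_def)
  show ?lo
    by (subst Umean_eq_sum_cavity, rule lo, assumption, unfold ratio, rule sum.cong)
       (simp_all add: upper_sol_eq[OF t e] GammaN_def)
  show ?up
    by (subst Umean_eq_sum_cavity, rule up, assumption, unfold ratio, rule sum.cong)
       (simp_all add: lower_sol_eq[OF t e] GammaN_def mult.commute)
qed

end

text \<open>For an edge ab this is the probability, computed at a with the lower weights, that ab is
  occupied; computed at b with the upper weights it is the same number. Used as mass sent from a to
  b, it makes the outflow at the root the lower mean size and the inflow the upper one.\<close>

definition net_occupation :: "real \<Rightarrow> net \<times> nat \<times> nat \<Rightarrow> ennreal" where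
  "net_occupation t = (\<lambda>(G, a, b). if net_edge G a b
     then ennreal (net_lower t G b a * net_upper t G a b / (t + net_lower t G b a * net_upper t G a b))
     else 0)"

lemma net_edge_sym: "net_edge G a b \<Longrightarrow> net_edge G b a"
  by (auto simp: net_edge_def)

lemma net_occupation_measurable:
  "net_occupation t \<in> borel_measurable (M_net \<Otimes>\<^sub>M (count_space UNIV \<Otimes>\<^sub>M count_space UNIV))"
  unfolding net_occupation_def by (rule measurable_net_pair) measurable

lemma net_occupation_iso_invariant: "iso_invariant (net_occupation t)"
  unfolding iso_invariant_def net_occupation_def
  by (auto simp: net_iso_edge net_iso_sol net_edge_sym)

text \<open>Finiteness legitimises subtracting the integrals, and a nonnegative difference with
  integral 0 vanishes almost everywhere.\<close>

lemma nn_integral_eq_imp_AE_eq: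
  assumes f: "f \<in> borel_measurable M" and g: "g \<in> borel_measurable M"
    and le: "AE x in M. f x \<le> g x"
    and eq: "(\<integral>\<^sup>+ x. f x \<partial>M) = (\<integral>\<^sup>+ x. g x \<partial>M)" and fin: "(\<integral>\<^sup>+ x. g x \<partial>M) < \<infinity>"
  shows "AE x in M. f x = (g x :: ennreal)"
proof -
  have "(\<integral>\<^sup>+ x. g x - f x \<partial>M) = (\<integral>\<^sup>+ x. g x \<partial>M) - (\<integral>\<^sup>+ x. f x \<partial>M)"
    using fin eq by (intro nn_integral_diff g f le) auto
  also have "\<dots> = 0" using fin by (simp add: eq)
  finally have "AE x in M. g x - f x = 0"
    using f g by (subst (asm) nn_integral_0_iff_AE) auto
  moreover have "AE x in M. g x \<noteq> \<infinity>" by (rule nn_integral_PInf_AE[OF g]) (use fin in auto)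
  ultimately show ?thesis using le
    by eventually_elim (simp add: diff_eq_0_iff_ennreal antisym less_top)
qed

section \<open>Mass transport under a unimodular law\<close>

locale unimodular_cavity =
  fixes L :: "net measure"
  assumes unimodular: "unimodular_law L"
    and AE_cm: "AE G in L. cm_network (net_V G) (net_E G) (net_mu G)"
    and rank_integrable: "(\<integral>\<^sup>+ G. ennreal (real (rank_meas (nbrs (net_E G) 0) (net_mu G 0))) \<partial>L) < \<infinity>"
begin

definition cavity_net :: "net \<Rightarrow> bool" where
  "cavity_net G \<longleftrightarrow> cm_network (net_V G) (net_E G) (net_mu G) \<and> rooted_net G"

lemma AE_cavity_net: "AE G in L. cavity_net G"
  using AE_cm unimodular unfolding cavity_net_def unimodular_law_def by auto

lemma cavity_netD:
  assumes "cavity_net G"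
  shows "cavity_network (net_V G) (net_edge G) (net_mu G)" and "net_edge G = net_E G" and "0 \<in> net_V G"
  using assms net_edge_eq[of G]
  by (auto simp: cavity_net_def rooted_net_def cavity_network_def cm_network_def)

lemma sets_L [measurable_cong]: "sets L = sets M_net"
  using unimodular by (simp add: unimodular_law_def)

lemma mass_transport:
  assumes "f \<in> borel_measurable (M_net \<Otimes>\<^sub>M (count_space UNIV \<Otimes>\<^sub>M count_space UNIV))" and "iso_invariant f"
  shows "(\<integral>\<^sup>+ G. (\<Sum>i\<in>nbrs (net_E G) 0. f (G, 0, i)) \<partial>L) = (\<integral>\<^sup>+ G. (\<Sum>i\<in>nbrs (net_E G) 0. f (G, i, 0)) \<partial>L)"
  using unimodular assms by (simp add: unimodular_law_def)

text \<open>Let every vertex send mass 1 to each neighbour that violates \<open>Q\<close>. The root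
  almost surely receives nothing, so by mass transport it almost surely sends nothing.\<close>

lemma AE_root_imp_AE_nbrs:
  assumes [measurable]: "\<And>v. Measurable.pred M_net (\<lambda>G. Q G v)"
    and iso: "\<And>G G' p v. net_iso G G' p \<Longrightarrow> v \<in> net_V G \<Longrightarrow> Q G' (p v) = Q G v"
    and root: "AE G in L. Q G 0"
  shows "AE G in L. \<forall>i. net_edge G 0 i \<longrightarrow> Q G i"
proof -
  define f :: "net \<times> nat \<times> nat \<Rightarrow> ennreal" where
    "f = (\<lambda>(G, a, b). if net_edge G a b \<and> \<not> Q G b then 1 else 0)"
  have meas: "f \<in> borel_measurable (M_net \<Otimes>\<^sub>M (count_space UNIV \<Otimes>\<^sub>M count_space UNIV))"
    unfolding f_def by (rule measurable_net_pair) measurable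
  have inv: "iso_invariant f"
    unfolding iso_invariant_def f_def by (auto simp: net_iso_edge iso)
  have [measurable]: "(\<lambda>G. f (G, 0, i)) \<in> borel_measurable M_net" for i
    unfolding f_def by measurable
  \<comment> \<open>Passing from the random neighbourhood to a series over all naturals gives a
    fixed index set, for which measurability is immediate.\<close>
  have "(\<integral>\<^sup>+ G. (\<Sum>i. f (G, 0, i)) \<partial>L) = (\<integral>\<^sup>+ G. (\<Sum>i\<in>nbrs (net_E G) 0. f (G, 0, i)) \<partial>L)"
  proof (rule nn_integral_cong_AE, use AE_cavity_net in eventually_elim)
    fix G assume G: "cavity_net G"
    interpret cavity_network "net_V G" "net_edge G" "net_mu G" by (rule cavity_netD[OF G])
    interpret cavity_measure "nbrs (net_edge G) 0" "net_mu G 0"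
      by (rule cavity_measure_at[OF cavity_netD(3)[OF G]])
    show "(\<Sum>i. f (G, 0, i)) = (\<Sum>i\<in>nbrs (net_E G) 0. f (G, 0, i))"
      using finite_S unfolding cavity_netD(2)[OF G]
      by (intro suminf_finite) (auto simp: f_def nbrs_def net_edge_def)
  qed
  also have "\<dots> = (\<integral>\<^sup>+ G. (\<Sum>i\<in>nbrs (net_E G) 0. f (G, i, 0)) \<partial>L)"
    by (rule mass_transport[OF meas inv])
  also have "\<dots> = (\<integral>\<^sup>+ G. 0 \<partial>L)"
    by (rule nn_integral_cong_AE, use root in eventually_elim) (simp add: f_def)
  also have "\<dots> = 0" by simp
  finally have "AE G in L. (\<Sum>i. f (G, 0, i)) = 0"
    by (subst (asm) nn_integral_0_iff_AE) auto
  then show ?thesis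
  proof eventually_elim
    case (elim G)
    then have "\<forall>i. f (G, 0, i) = 0"
      by (subst (asm) suminf_eq_zero_iff) auto
    then show ?case by (auto simp: f_def split: if_splits)
  qed
qed

text \<open>Connectedness puts every vertex at the end of a walk from the root. Each walk length
  costs one null set, and there are countably many lengths.\<close>

lemma AE_root_imp_AE_everywhere:
  assumes "\<And>v. Measurable.pred M_net (\<lambda>G. Q G v)"
    and "\<And>G G' p v. net_iso G G' p \<Longrightarrow> v \<in> net_V G \<Longrightarrow> Q G' (p v) = Q G v"
    and "AE G in L. Q G 0"
  shows "AE G in L. \<forall>v\<in>net_V G. Q G v"
proof -
  \<comment> \<open>\<open>R n\<close> quantifies over the endpoints of walks of length n and is
    itself measurable and invariant, so the one-step result can be applied to it again.\<close>
  define R where "R n G v \<longleftrightarrow> (\<forall>u. (v, u) \<in> {(a, b). net_edge G a b} ^^ n \<longrightarrow> Q G u)" for n G v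
  \<comment> \<open>The first step of the walk is peeled off, not the last, because mass transport
    moves a property from the root to its neighbours.\<close>
  have R_Suc: "R (Suc n) G v \<longleftrightarrow> (\<forall>u. net_edge G v u \<longrightarrow> R n G u)" for n G v
  proof -
    let ?E = "{(a, b). net_edge G a b}"
    have "(v, u) \<in> ?E ^^ Suc n \<longleftrightarrow> (\<exists>w. net_edge G v w \<and> (w, u) \<in> ?E ^^ n)" for u
      using relpow_Suc_I2[of v _ ?E u n] relpow_Suc_D2[of v u n ?E] by auto
    then show ?thesis unfolding R_def by blast
  qed
  have "(\<forall>v. Measurable.pred M_net (\<lambda>G. R n G v)) \<and>
      (\<forall>G G' p v. net_iso G G' p \<longrightarrow> v \<in> net_V G \<longrightarrow> R n G' (p v) = R n G v) \<and>
      (AE G in L. R n G 0)" for n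
  proof (induction n)
    case 0 then show ?case using assms by (simp add: R_def)
  next
    case (Suc n)
    then have [measurable]: "Measurable.pred M_net (\<lambda>G. R n G v)"
      and iso: "net_iso G G' p \<Longrightarrow> v \<in> net_V G \<Longrightarrow> R n G' (p v) = R n G v"
      and root: "AE G in L. R n G 0" for v G G' p by blast+
    have "Measurable.pred M_net (\<lambda>G. R (Suc n) G v)" for v unfolding R_Suc by measurable
    moreover have "R (Suc n) G' (p v) = R (Suc n) G v" if "net_iso G G' p" "v \<in> net_V G" for G G' p v
    proof -
      have "R (Suc n) G' (p v) \<longleftrightarrow> (\<forall>u\<in>nbrs (net_edge G') (p v). R n G' u)"
        by (simp add: R_Suc nbrs_def)
      also have "\<dots> \<longleftrightarrow> (\<forall>u\<in>nbrs (net_edge G) v. R n G' (p u))"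
        by (simp add: net_iso_nbrs[OF that])
      also have "\<dots> \<longleftrightarrow> (\<forall>u\<in>nbrs (net_edge G) v. R n G u)"
        using iso[OF that(1)] nbrs_net_edge_subset(1)[of G v] by blast
      finally show ?thesis by (simp add: R_Suc nbrs_def)
    qed
    moreover have "AE G in L. R (Suc n) G 0"
      unfolding R_Suc
    proof (rule AE_root_imp_AE_nbrs[of "R n"])
      show "Measurable.pred M_net (\<lambda>G. R n G v)" for v by measurable
      show "R n G' (p v) = R n G v" if "net_iso G G' p" "v \<in> net_V G" for G G' p v
        using that by (rule iso)
    qed (rule root)
    ultimately show ?case by blast
  qed
  then have "AE G in L. \<forall>n. R n G 0" by (simp add: AE_all_countable)
  with AE_cavity_net show ?thesis
  proof eventually_elim
    case (elim G)
    show ?case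
    proof
      fix v assume "v \<in> net_V G"
      then have "(0, v) \<in> {(a, b). net_edge G a b}\<^sup>*"
        using elim(1) by (simp add: cavity_netD(2)[OF elim(1)]) (simp add: cavity_net_def rooted_net_def)
      then obtain n where "(0, v) \<in> {(a, b). net_edge G a b} ^^ n" by (auto simp: rtrancl_power)
      then show "Q G v" using elim(2) by (auto simp: R_def)
    qed
  qed
qed

lemma AE_root_sol_eq:
  assumes t: "0 < t"
  shows "AE G in L. \<forall>i. net_edge G i 0 \<longrightarrow> net_lower t G i 0 = net_upper t G i 0"
proof -
  define Ulo where "Ulo G = Umean (nbrs (net_edge G) 0) (net_mu G 0) (\<lambda>i. net_lower t G i 0)" for G
  define Uup where "Uup G = Umean (nbrs (net_edge G) 0) (net_mu G 0) (\<lambda>i. net_upper t G i 0)" for G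
  have [measurable]: "(\<lambda>G. Ulo G) \<in> borel_measurable M_net"
    unfolding Ulo_def by (rule measurable_net_Umean) measurable
  have [measurable]: "(\<lambda>G. Uup G) \<in> borel_measurable M_net"
    unfolding Uup_def by (rule measurable_net_Umean) measurable
  \<comment> \<open>All facts about a single network are collected in one predicate, so that every
    integral comparison below refers to the same almost sure event.\<close>
  define good where "good G \<longleftrightarrow> ennreal (Ulo G) = (\<Sum>i\<in>nbrs (net_E G) 0. net_occupation t (G, 0, i))
      \<and> ennreal (Uup G) = (\<Sum>i\<in>nbrs (net_E G) 0. net_occupation t (G, i, 0))
      \<and> Ulo G \<le> Uup G \<and> 0 \<le> Ulo G \<and> Uup G \<le> real (rank_meas (nbrs (net_E G) 0) (net_mu G 0))
      \<and> (Ulo G = Uup G \<longrightarrow> (\<forall>i. net_edge G i 0 \<longrightarrow> net_lower t G i 0 = net_upper t G i 0))" for G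
  have goodD: "ennreal (Ulo G) = (\<Sum>i\<in>nbrs (net_E G) 0. net_occupation t (G, 0, i))"
      "(\<Sum>i\<in>nbrs (net_E G) 0. net_occupation t (G, i, 0)) = ennreal (Uup G)"
      "Ulo G \<le> Uup G" "0 \<le> Ulo G" "Uup G \<le> real (rank_meas (nbrs (net_E G) 0) (net_mu G 0))"
      "Ulo G = Uup G \<Longrightarrow> \<forall>i. net_edge G i 0 \<longrightarrow> net_lower t G i 0 = net_upper t G i 0"
    if "good G" for G
    using that unfolding good_def by simp_all
  have AE: "AE G in L. good G"
    using AE_cavity_net
  proof eventually_elim
    case (elim G)
    note D = cavity_netD[OF elim]
    interpret cavity_network "net_V G" "net_edge G" "net_mu G" by (rule D)
    interpret cavity_measure "nbrs (net_edge G) 0" "net_mu G 0" by (rule cavity_measure_at[OF D(3)])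
    have e: "net_edge G 0 i" "net_edge G i 0" if "i \<in> nbrs (net_edge G) 0" for i
      using that E_sym[of 0 i] by (simp_all add: nbrs_def)
    have lo: "0 < net_lower t G i 0" "0 < net_lower t G 0 i"
      and le: "net_lower t G i 0 \<le> net_upper t G i 0" "net_lower t G 0 i \<le> net_upper t G 0 i"
      if "i \<in> nbrs (net_edge G) 0" for i
      by (intro lower_sol_pos[OF t] lower_le_upper[OF t] e that)+
    have up: "0 \<le> net_upper t G i 0" "0 \<le> net_upper t G 0 i" if "i \<in> nbrs (net_edge G) 0" for i
      using lo[OF that] le[OF that] by simp_all
    have frac: "0 \<le> x * y / (t + x * y)" if "0 \<le> x" "0 \<le> y" for x y
      using that t by simp
    have 1: "ennreal (Ulo G) = (\<Sum>i\<in>nbrs (net_edge G) 0. net_occupation t (G, 0, i))"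
      unfolding Ulo_def Umean_sol_eq(1)[OF t D(3)]
    proof (subst sum_ennreal[symmetric])
      fix i assume "i \<in> nbrs (net_edge G) 0"
      then show "0 \<le> net_lower t G i 0 * net_upper t G 0 i / (t + net_lower t G i 0 * net_upper t G 0 i)"
        by (intro frac less_imp_le[OF lo(1)] up)
    qed (rule sum.cong, simp_all add: net_occupation_def e)
    have 2: "ennreal (Uup G) = (\<Sum>i\<in>nbrs (net_edge G) 0. net_occupation t (G, i, 0))"
      unfolding Uup_def Umean_sol_eq(2)[OF t D(3)]
    proof (subst sum_ennreal[symmetric])
      fix i assume "i \<in> nbrs (net_edge G) 0"
      then show "0 \<le> net_lower t G 0 i * net_upper t G i 0 / (t + net_lower t G 0 i * net_upper t G i 0)"
        by (intro frac less_imp_le[OF lo(2)] up)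
    qed (rule sum.cong, simp_all add: net_occupation_def e)
    have 3: "Ulo G \<le> Uup G" unfolding Ulo_def Uup_def by (intro Umean_mono less_imp_le[OF lo(1)] le(1))
    have 4: "0 \<le> Ulo G" unfolding Ulo_def by (intro Umean_nonneg less_imp_le[OF lo(1)])
    have 5: "Uup G \<le> real (rank_meas (nbrs (net_edge G) 0) (net_mu G 0))"
      unfolding Uup_def by (intro Umean_le_rank up)
    have 6: "net_lower t G i 0 = net_upper t G i 0"
      if "Ulo G = Uup G" "net_edge G i 0" for i
    proof -
      have "i \<in> nbrs (net_edge G) 0" using E_sym[OF that(2)] by (simp add: nbrs_def)
      with lo(1) le(1) that(1)[unfolded Ulo_def Uup_def] show ?thesis by (rule Umean_eq_imp_eq)
    qed
    show ?case
      unfolding good_def using 1 2 3 4 5 6 unfolding D(2) by (intro conjI allI impI)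
  qed
  have "(\<integral>\<^sup>+ G. ennreal (Ulo G) \<partial>L) = (\<integral>\<^sup>+ G. (\<Sum>i\<in>nbrs (net_E G) 0. net_occupation t (G, 0, i)) \<partial>L)"
    by (rule nn_integral_cong_AE, use AE in eventually_elim) (rule goodD)
  also have "\<dots> = (\<integral>\<^sup>+ G. (\<Sum>i\<in>nbrs (net_E G) 0. net_occupation t (G, i, 0)) \<partial>L)"
    by (rule mass_transport[OF net_occupation_measurable net_occupation_iso_invariant])
  also have "\<dots> = (\<integral>\<^sup>+ G. ennreal (Uup G) \<partial>L)"
    by (rule nn_integral_cong_AE, use AE in eventually_elim) (rule goodD)
  finally have eq: "(\<integral>\<^sup>+ G. ennreal (Ulo G) \<partial>L) = (\<integral>\<^sup>+ G. ennreal (Uup G) \<partial>L)" .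
  \<comment> \<open>The rank bound excludes the case of two infinite integrals, in which equality
    would say nothing about the integrands.\<close>
  have "(\<integral>\<^sup>+ G. ennreal (Uup G) \<partial>L)
      \<le> (\<integral>\<^sup>+ G. ennreal (real (rank_meas (nbrs (net_E G) 0) (net_mu G 0))) \<partial>L)"
    by (rule nn_integral_mono_AE, use AE in eventually_elim) (intro ennreal_leI goodD)
  then have fin: "(\<integral>\<^sup>+ G. ennreal (Uup G) \<partial>L) < \<infinity>"
    using rank_integrable by (rule le_less_trans)
  have "AE G in L. ennreal (Ulo G) \<le> ennreal (Uup G)"
    using AE by eventually_elim (intro ennreal_leI goodD)
  then have "AE G in L. ennreal (Ulo G) = ennreal (Uup G)"
    by (intro nn_integral_eq_imp_AE_eq eq fin) measurable
  with AE show ?thesis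
  proof eventually_elim
    case (elim G)
    note G = goodD[OF elim(1)]
    have "Ulo G = Uup G" using elim(2) G(3,4) by (simp add: ennreal_inj)
    then show ?case by (rule G(6))
  qed
qed

lemma AE_has_unique_GAS:
  "AE G in L. \<forall>t>0. has_unique_GAS (net_edge G) (net_mu G) t"
proof -
  have "AE G in L. \<forall>v\<in>net_V G. \<forall>i. net_edge G i v \<longrightarrow> net_lower t G i v = net_upper t G i v"
    if "0 < t" for t
  proof (rule AE_root_imp_AE_everywhere)
    show "Measurable.pred M_net (\<lambda>G. \<forall>i. net_edge G i v \<longrightarrow> net_lower t G i v = net_upper t G i v)" for v
      by measurable
    show "AE G in L. \<forall>i. net_edge G i 0 \<longrightarrow> net_lower t G i 0 = net_upper t G i 0"
      by (rule AE_root_sol_eq[OF that])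
    fix G G' :: net and p v assume iso: "net_iso G G' p" and v: "v \<in> net_V G"
    have nb: "(\<forall>i. net_edge H i u \<longrightarrow> P i) \<longleftrightarrow> (\<forall>i\<in>nbrs (net_edge H) u. P i)" for H u P
      by (auto simp: nbrs_def intro: net_edge_sym)
    have "net_edge G i v" if "i \<in> nbrs (net_edge G) v" for i
      using that by (auto simp: nbrs_def intro: net_edge_sym)
    then show "(\<forall>i. net_edge G' i (p v) \<longrightarrow> net_lower t G' i (p v) = net_upper t G' i (p v))
        = (\<forall>i. net_edge G i v \<longrightarrow> net_lower t G i v = net_upper t G i v)"
      unfolding nb net_iso_nbrs[OF iso v] by (simp add: net_iso_sol[OF iso])
  qed
  \<comment> \<open>The null set of the preceding statement depends on the activity; rational
    activities keep the union null, and \<open>lower_eq_upper_if_rat\<close> then recovers all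
    others on the same event.\<close>
  then have "AE G in L. \<forall>q::rat. 0 < q \<longrightarrow> (\<forall>v\<in>net_V G. \<forall>i. net_edge G i v \<longrightarrow>
      net_lower (of_rat q) G i v = net_upper (of_rat q) G i v)"
    by (simp add: AE_all_countable)
  with AE_cavity_net show ?thesis
  proof eventually_elim
    case (elim G)
    interpret cavity_network "net_V G" "net_edge G" "net_mu G" by (rule cavity_netD[OF elim(1)])
    show ?case
    proof (intro allI impI has_unique_GAS_if)
      fix t :: real and i j assume t: "0 < t" and e: "net_edge G i j"
      have "net_lower (of_rat q) G i j = net_upper (of_rat q) G i j" if "0 < q" for q
        using elim(2) that e by (auto simp: net_edge_def)
      then show "net_lower t G i j = net_upper t G i j"
        using t e by (rule lower_eq_upper_if_rat)
    qed
  qed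
qed

text \<open>At almost every network the mean size at the root increases in the activity to its value
  at \<open>xbar\<close>. Monotone convergence is applied along integer activities, and monotonicity
  of \<open>u_fun\<close> fills the gaps between them.\<close>

lemma u_fun_tendsto:
  "((\<lambda>t. u_fun L t) \<longlongrightarrow> ennreal (1/2) * (\<integral>\<^sup>+ G. ennreal (Uext (nbrs (net_E G) 0) (net_mu G 0)
      (\<lambda>i. xbar (net_E G) (net_mu G) i 0)) \<partial>L)) at_top"
proof -
  define U where "U t G = Umean (nbrs (net_E G) 0) (net_mu G 0) (\<lambda>i. xsol (net_E G) (net_mu G) t i 0)"
    for t G
  define Ubar where "Ubar G = Uext (nbrs (net_E G) 0) (net_mu G 0) (\<lambda>i. xbar (net_E G) (net_mu G) i 0)" for G
  \<comment> \<open>This measurable version of \<open>U\<close> comes from the iterates instead of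
    the choice operator; the two agree almost surely at all positive activities.\<close>
  define U' where "U' t G = Umean (nbrs (net_edge G) 0) (net_mu G 0) (\<lambda>i. net_lower t G i 0)" for t G
  define good where "good G \<longleftrightarrow> (\<forall>s t. 0 < s \<longrightarrow> s \<le> t \<longrightarrow> U s G \<le> U t G) \<and> ((\<lambda>t. U t G) \<longlongrightarrow> Ubar G) at_top
      \<and> (\<forall>t>0. U t G = U' t G)" for G
  have U_mono: "U s G \<le> U t G" if "good G" "0 < s" "s \<le> t" for G s t
    using that unfolding good_def by blast
  have U_lim: "((\<lambda>t. U t G) \<longlongrightarrow> Ubar G) at_top" if "good G" for G
    using that unfolding good_def by blast
  have U_eq: "U' t G = U t G" if "good G" "0 < t" for G t
    using that unfolding good_def by simp
  have AE: "AE G in L. good G"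
    using AE_cavity_net AE_has_unique_GAS
  proof eventually_elim
    case (elim G)
    note D = cavity_netD[OF elim(1)]
    interpret cavity_network "net_V G" "net_edge G" "net_mu G" by (rule D)
    interpret cavity_measure "nbrs (net_edge G) 0" "net_mu G 0" by (rule cavity_measure_at[OF D(3)])
    have reg: "has_unique_GAS (net_edge G) (net_mu G) t" if "0 < t" for t using elim that by blast
    let ?x = "\<lambda>t i. xsol (net_edge G) (net_mu G) t i 0"
    have e: "net_edge G k 0" if "k \<in> nbrs (net_edge G) 0" for k by (rule nbrs_sym[OF that])
    have "Umean (nbrs (net_edge G) 0) (net_mu G 0) (?x s) \<le> Umean (nbrs (net_edge G) 0) (net_mu G 0) (?x t)"
      if "0 < s" "s \<le> t" for s t
      using that by (intro Umean_mono xsol_mono[OF reg] xsol_nonneg[OF reg] e)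
    then have "\<forall>s t. 0 < s \<longrightarrow> s \<le> t \<longrightarrow> U s G \<le> U t G"
      unfolding U_def D(2)[symmetric] by blast
    moreover have "Umean (nbrs (net_edge G) 0) (net_mu G 0) (?x t) = U' t G" if "0 < t" for t
      unfolding U'_def using that by (intro Umean_cong xsol_eq(1)[OF reg] e)
    then have "\<forall>t>0. U t G = U' t G" unfolding U_def D(2)[symmetric] by blast
    moreover have "((\<lambda>t. Umean (nbrs (net_edge G) 0) (net_mu G 0) (?x t)) \<longlongrightarrow>
        Uext (nbrs (net_edge G) 0) (net_mu G 0) (\<lambda>i. xbar (net_edge G) (net_mu G) i 0)) at_top"
    proof (rule Umean_truncation)
      fix k assume k: "k \<in> nbrs (net_edge G) 0"
      show "0 \<le> xbar (net_edge G) (net_mu G) k 0"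
        by (rule less_imp_le[OF xbar_pos[OF reg e[OF k]]])
      show "((\<lambda>t. ereal (?x t k)) \<longlongrightarrow> xbar (net_edge G) (net_mu G) k 0) at_top"
        by (rule xbar_tendsto(1)[OF reg e[OF k]])
    next
      show "\<forall>\<^sub>F t in at_top. \<forall>k\<in>nbrs (net_edge G) 0. 0 \<le> ?x t k
          \<and> ereal (?x t k) \<le> xbar (net_edge G) (net_mu G) k 0"
        using eventually_gt_at_top[of 0]
        by eventually_elim (intro ballI conjI xsol_nonneg[OF reg] xbar_tendsto(2)[OF reg] e)
    qed
    then have "((\<lambda>t. U t G) \<longlongrightarrow> Ubar G) at_top" unfolding U_def Ubar_def D(2)[symmetric] .
    ultimately show ?case unfolding good_def by blast
  qed
  have [measurable]: "(\<lambda>G. U' t G) \<in> borel_measurable M_net" for t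
    unfolding U'_def by (rule measurable_net_Umean) measurable
  have u: "u_fun L t = ennreal (1/2) * (\<integral>\<^sup>+ G. ennreal (U t G) \<partial>L)" for t
    by (simp add: u_fun_def U_def)
  have mono: "u_fun L s \<le> u_fun L t" if "0 < s" "s \<le> t" for s t
    unfolding u
    by (intro mult_left_mono nn_integral_mono_AE, use AE in eventually_elim)
       (intro ennreal_leI U_mono that, simp_all)
  let ?l = "ennreal (1/2) * (\<integral>\<^sup>+ G. ennreal (Ubar G) \<partial>L)"
  have le: "u_fun L t \<le> ?l" if "0 < t" for t
    unfolding u
  proof (intro mult_left_mono nn_integral_mono_AE, use AE in eventually_elim)
    fix G assume G: "good G"
    have "U t G \<le> Ubar G"
    proof (rule tendsto_lowerbound[OF U_lim[OF G]])
      show "\<forall>\<^sub>F s in at_top. U t G \<le> U s G"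
        using eventually_ge_at_top[of t] by eventually_elim (rule U_mono[OF G that])
    qed simp
    then show "ennreal (U t G) \<le> ennreal (Ubar G)" by (rule ennreal_leI)
  qed simp
  \<comment> \<open>The successor keeps the activity positive at n = 0.\<close>
  have lim: "(\<lambda>n. u_fun L (real (Suc n))) \<longlonglongrightarrow> ?l"
  proof -
    have SUP: "(\<integral>\<^sup>+ G. (SUP n. ennreal (U' (real (Suc n)) G)) \<partial>L)
        = (SUP n. \<integral>\<^sup>+ G. ennreal (U' (real (Suc n)) G) \<partial>L)"
    proof (rule nn_integral_monotone_convergence_SUP_AE)
      fix n
      show "AE G in L. ennreal (U' (real (Suc n)) G) \<le> ennreal (U' (real (Suc (Suc n))) G)"
        using AE
      proof eventually_elim
        case (elim G)
        show ?case
          unfolding U_eq[OF elim of_nat_0_less_iff[THEN iffD2, OF zero_less_Suc]]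
          by (intro ennreal_leI U_mono[OF elim]) simp_all
      qed
    qed measurable
    have "(\<integral>\<^sup>+ G. (SUP n. ennreal (U' (real (Suc n)) G)) \<partial>L) = (\<integral>\<^sup>+ G. ennreal (Ubar G) \<partial>L)"
    proof (rule nn_integral_cong_AE, use AE in eventually_elim)
      fix G assume G: "good G"
      have eq: "U' (real (Suc n)) G = U (real (Suc n)) G" for n by (rule U_eq[OF G]) simp
      have "incseq (\<lambda>n. ennreal (U (real (Suc n)) G))"
        by (intro incseq_SucI ennreal_leI U_mono[OF G]) simp_all
      then have "(\<lambda>n. ennreal (U (real (Suc n)) G)) \<longlonglongrightarrow> (SUP n. ennreal (U (real (Suc n)) G))"
        by (rule LIMSEQ_SUP)
      moreover have "(\<lambda>n. ennreal (U (real (Suc n)) G)) \<longlonglongrightarrow> ennreal (Ubar G)"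
      proof (rule tendsto_ennrealI)
        have "filterlim (\<lambda>n. real (Suc n)) at_top sequentially"
          by (rule filterlim_compose[OF filterlim_real_sequentially filterlim_Suc])
        then show "(\<lambda>n. U (real (Suc n)) G) \<longlonglongrightarrow> Ubar G"
          by (rule filterlim_compose[OF U_lim[OF G]])
      qed
      ultimately show "(SUP n. ennreal (U' (real (Suc n)) G)) = ennreal (Ubar G)"
        unfolding eq by (rule LIMSEQ_unique)
    qed
    moreover have "(\<integral>\<^sup>+ G. ennreal (U' (real (Suc n)) G) \<partial>L) = (\<integral>\<^sup>+ G. ennreal (U (real (Suc n)) G) \<partial>L)" for n
      by (rule nn_integral_cong_AE, use AE in eventually_elim)
         (rule arg_cong[of _ _ ennreal], rule U_eq, simp_all)
    ultimately have "?l = ennreal (1/2) * (SUP n. \<integral>\<^sup>+ G. ennreal (U (real (Suc n)) G) \<partial>L)"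
      using SUP by (simp only:)
    then have "?l = (SUP n. u_fun L (real (Suc n)))"
      unfolding u by (simp only: SUP_mult_left_ennreal)
    moreover have "incseq (\<lambda>n. u_fun L (real (Suc n)))"
      by (intro incseq_SucI mono) simp_all
    then have "(\<lambda>n. u_fun L (real (Suc n))) \<longlonglongrightarrow> (SUP n. u_fun L (real (Suc n)))"
      by (rule LIMSEQ_SUP)
    ultimately show ?thesis by (simp only:)
  qed
  have "((\<lambda>t. u_fun L t) \<longlongrightarrow> ?l) at_top"
  proof (rule order_tendstoI)
    fix a assume "a < ?l"
    then have "\<forall>\<^sub>F n in sequentially. a < u_fun L (real (Suc n))"
      using lim by (simp add: order_tendsto_iff)
    then obtain n where n: "a < u_fun L (real (Suc n))" by (auto simp: eventually_sequentially)
    show "\<forall>\<^sub>F t in at_top. a < u_fun L t"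
      using eventually_ge_at_top[of "real (Suc n)"]
      by eventually_elim (rule less_le_trans[OF n mono], auto)
  next
    fix a assume "?l < a"
    then show "\<forall>\<^sub>F t in at_top. u_fun L t < a"
      using le by (intro eventually_mono[OF eventually_gt_at_top[of 0]]) (rule le_less_trans)
  qed
  then show ?thesis by (simp add: Ubar_def)
qed

end

section \<open>The deterministic and the unimodular half combined\<close>

theorem mainTheorem9:
  shows "(\<forall>(V::'v set) E mu.
           cm_network V E mu \<and> (\<forall>t::real. 0 < t \<longrightarrow> has_unique_GAS E mu t) \<longrightarrow>
             (\<forall>s t::real. 0 < s \<longrightarrow> s \<le> t \<longrightarrow>
                (\<forall>i j. E i j \<longrightarrow> xsol E mu s i j \<le> xsol E mu t i j))
           \<and> (\<forall>i j. E i j \<longrightarrow>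
                ((\<lambda>t. ereal (xsol E mu t i j)) \<longlongrightarrow> xbar E mu i j) at_top \<and> 0 < xbar E mu i j)
           \<and> inf_cavity_eq E mu (xbar E mu)
           \<and> (\<forall>y. (\<forall>i j. E i j \<longrightarrow> 0 < y i j) \<longrightarrow> inf_cavity_eq E mu y \<longrightarrow>
                (\<forall>i j. E i j \<longrightarrow> xbar E mu i j \<le> y i j)))
       \<and> (\<forall>L. unimodular_law L \<and>
              (AE G in L. cm_network (net_V G) (net_E G) (net_mu G)) \<and>
              (\<integral>\<^sup>+ G. ennreal (real (rank_meas (nbrs (net_E G) 0) (net_mu G 0))) \<partial>L) < \<infinity> \<longrightarrow>
            ((\<lambda>t. u_fun L t) \<longlongrightarrow>
               ennreal (1/2) * (\<integral>\<^sup>+ G. ennreal (Uext (nbrs (net_E G) 0) (net_mu G 0)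
                   (\<lambda>i. xbar (net_E G) (net_mu G) i 0)) \<partial>L)) at_top)"
  (is "?network \<and> ?unimodular")
proof
  show ?network
  proof (intro allI impI, elim conjE)
    fix V :: "'v set" and E mu
    assume "cm_network V E mu" and reg: "\<forall>t::real. 0 < t \<longrightarrow> has_unique_GAS E mu t"
    then interpret cavity_network V E mu by unfold_locales
    have regular: "has_unique_GAS E mu t" if "0 < t" for t using reg that by blast
    show "(\<forall>s t::real. 0 < s \<longrightarrow> s \<le> t \<longrightarrow>
                (\<forall>i j. E i j \<longrightarrow> xsol E mu s i j \<le> xsol E mu t i j))
           \<and> (\<forall>i j. E i j \<longrightarrow>
                ((\<lambda>t. ereal (xsol E mu t i j)) \<longlongrightarrow> xbar E mu i j) at_top \<and> 0 < xbar E mu i j)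
           \<and> inf_cavity_eq E mu (xbar E mu)
           \<and> (\<forall>y. (\<forall>i j. E i j \<longrightarrow> 0 < y i j) \<longrightarrow> inf_cavity_eq E mu y \<longrightarrow>
                (\<forall>i j. E i j \<longrightarrow> xbar E mu i j \<le> y i j))"
      by (intro conjI allI impI)
         (simp_all add: regular xsol_mono xbar_tendsto(1) xbar_pos xbar_inf_cavity_eq xbar_least)
  qed
  show ?unimodular
  proof (intro allI impI, elim conjE)
    fix L
    assume "unimodular_law L" "AE G in L. cm_network (net_V G) (net_E G) (net_mu G)"
      "(\<integral>\<^sup>+ G. ennreal (real (rank_meas (nbrs (net_E G) 0) (net_mu G 0))) \<partial>L) < \<infinity>"
    then interpret unimodular_cavity L by unfold_locales
    show "((\<lambda>t. u_fun L t) \<longlongrightarrow> ennreal (1/2) * (\<integral>\<^sup>+ G. ennreal (Uext (nbrs (net_E G) 0) (net_mu G 0)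
        (\<lambda>i. xbar (net_E G) (net_mu G) i 0)) \<partial>L)) at_top"
      by (rule u_fun_tendsto)
  qed
qed

end
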